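(* Let $1\le k\le n$ be integers and let $\alpha=[\alpha_1\le\cdots\le\alpha_k]\in\mathbb N^k$ with $\alpha_k=n-k+1$. Let $I=(i_1>\cdots>i_{\ell(I)}>0)$ be a strict partition with $I\subseteq\rho(n)=(n,n-1,\ldots,1)$. Then the image $\widetilde Q_I\,Y_\alpha\,\nabla_k^B(n)$ of $\widetilde Q_I\,Y_\alpha$ under $\nabla_k^B(n)$ is $0$ unless $\ell(I)\not\equiv n \pmod 2$ and the integers $n-0-\alpha_1,\ n-1-\alpha_2,\ \ldots,\ n-(k-2)-\alpha_{k-1}$ are all parts of $I$. In this case $$\widetilde Q_I\,Y_\alpha\,\nabla_k^B(n)=(-1)^{(k-1)(n-1)+1+s}\,2^k\,\widetilde Q_J,$$ where $J$ is the strict partition with parts $\{i_1,\ldots,i_{\ell(I)}\}\smallsetminus\{n-0-\alpha_1,\ldots,n-(k-2)-\alpha_{k-1}\}$, and $s$ is the sum of the positions in $I$ of the erased parts (the part $i_p$ has position $p$).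
   Context: All operators act on what is written to their left, so products of operators are performed from left to right; polynomials used as operators act by multiplication. The operators act on $\mathbb Z[\tfrac12][x_1,\ldots,x_n]$. Simple divided differences: for $1\le i\le n-1$, $f\,\partial_i=\dfrac{f-f(\ldots,x_{i+1},x_i,\ldots)}{x_i-x_{i+1}}$ ($x_i$ and $x_{i+1}$ exchanged), and $f\,\partial_0=\dfrac{f-f(-x_1,x_2,\ldots,x_n)}{-x_1}$. For $k\le n$: $\nabla_k^B(n)=(\partial_0\partial_1\cdots\partial_{n-1})(\partial_0\partial_1\cdots\partial_{n-2})\cdots(\partial_0\partial_1\cdots\partial_{n-k})$, a product of $k$ factors. For $\alpha=[\alpha_1\le\cdots\le\alpha_k]\in\mathbb N^k$, $k\le n$, $Y_\alpha$ is the Schur polynomial $s_{(\alpha_k,\ldots,\alpha_1)}(x_1,\ldots,x_k)$. $\widetilde Q$-polynomials: let $e_i$ be the $i$-th elementary symmetric polynomial in $x_1,\ldots,x_n$ ($e_0=1$, $e_i=0$ for $i>n$). Put $\widetilde Q_i=e_i$ and, for $i\ge j\ge0$, $\widetilde Q_{i,j}=e_ie_j+2\sum_{p=1}^j(-1)^pe_{i+p}e_{j-p}$. For a partition $I=(i_1,\ldots,i_m)$ with $m$ even (append a $0$ if necessary), $\widetilde Q_I$ is the Pfaffian of the $m\times m$ skew-symmetric matrix whose $(p,q)$ entry for $p<q$ is $\widetilde Q_{i_p,i_q}$; $\widetilde Q_\emptyset=1$. A partition is strict if all its parts are distinct; $\ell(I)$ is the number of nonzero parts; $I\subseteq J$ for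 partitions means componentwise $\le$. *)

theory Defs
  imports
    "HOL-Library.Poly_Mapping"
    "HOL-Library.More_List"
    "Jordan_Normal_Form.Determinant"
begin

section \<open>The ring of dyadic rationals\<close>

text \<open>The coefficient ring $\mathbb{Z}[1/2]$, as a subring of the rationals.\<close>

typedef dyadic = "{x :: rat. \<exists>(a :: int) (m :: nat). x = of_int a / 2 ^ m}"
  morphisms rat_of_dyadic Abs_dyadic
proof
  show "0 \<in> {x :: rat. \<exists>(a :: int) (m :: nat). x = of_int a / 2 ^ m}"
    by (auto intro!: exI[of _ "0 :: int"])
qed

setup_lifting type_definition_dyadic

instantiation dyadic :: idom
begin

lift_definition zero_dyadic :: dyadic is 0
  by (rule exI[of _ 0]) simp

lift_definition one_dyadic :: dyadic is 1
  by (rule exI[of _ 1], rule exI[of _ 0]) simp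

lift_definition plus_dyadic :: "dyadic \<Rightarrow> dyadic \<Rightarrow> dyadic" is "(+)"
proof -
  fix x y :: rat
  assume "\<exists>(a :: int) (m :: nat). x = of_int a / 2 ^ m"
    and "\<exists>(a :: int) (m :: nat). y = of_int a / 2 ^ m"
  then obtain a b :: int and m l :: nat
    where "x = of_int a / 2 ^ m" "y = of_int b / 2 ^ l" by blast
  then have "x + y = of_int (a * 2 ^ l + b * 2 ^ m) / 2 ^ (m + l)"
    by (simp add: add_divide_distrib diff_divide_distrib power_add)
  then show "\<exists>(a :: int) (m :: nat). x + y = of_int a / 2 ^ m" by blast
qed

lift_definition uminus_dyadic :: "dyadic \<Rightarrow> dyadic" is uminus
proof -
  fix x :: rat
  assume "\<exists>(a :: int) (m :: nat). x = of_int a / 2 ^ m"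
  then obtain a :: int and m :: nat where "x = of_int a / 2 ^ m" by blast
  then have "- x = of_int (- a) / 2 ^ m" by simp
  then show "\<exists>(a :: int) (m :: nat). - x = of_int a / 2 ^ m" by blast
qed

lift_definition minus_dyadic :: "dyadic \<Rightarrow> dyadic \<Rightarrow> dyadic" is "(-)"
proof -
  fix x y :: rat
  assume "\<exists>(a :: int) (m :: nat). x = of_int a / 2 ^ m"
    and "\<exists>(a :: int) (m :: nat). y = of_int a / 2 ^ m"
  then obtain a b :: int and m l :: nat
    where "x = of_int a / 2 ^ m" "y = of_int b / 2 ^ l" by blast
  then have "x - y = of_int (a * 2 ^ l - b * 2 ^ m) / 2 ^ (m + l)"
    by (simp add: add_divide_distrib diff_divide_distrib power_add)
  then show "\<exists>(a :: int) (m :: nat). x - y = of_int a / 2 ^ m" by blast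
qed

lift_definition times_dyadic :: "dyadic \<Rightarrow> dyadic \<Rightarrow> dyadic" is "(*)"
proof -
  fix x y :: rat
  assume "\<exists>(a :: int) (m :: nat). x = of_int a / 2 ^ m"
    and "\<exists>(a :: int) (m :: nat). y = of_int a / 2 ^ m"
  then obtain a b :: int and m l :: nat
    where "x = of_int a / 2 ^ m" "y = of_int b / 2 ^ l" by blast
  then have "x * y = of_int (a * b) / 2 ^ (m + l)"
    by (simp add: power_add)
  then show "\<exists>(a :: int) (m :: nat). x * y = of_int a / 2 ^ m" by blast
qed

instance
  by (intro_classes; transfer) (auto simp: algebra_simps)

end

section \<open>Polynomials and divided differences\<close>

text \<open>Polynomials in countably many variables: the outer index is the exponent vector of a
  monomial. Variables are numbered from 1 on; index 0 is never used. Polynomials in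
  $x_1,\ldots,x_n$ are the elements in which no other variable occurs, and the operators below
  with index less than \<open>n\<close> preserve this subring.\<close>

type_synonym 'a mpoly = "(nat \<Rightarrow>\<^sub>0 nat) \<Rightarrow>\<^sub>0 'a"

definition X :: "nat \<Rightarrow> 'a :: comm_ring_1 mpoly" where
  "X i = Poly_Mapping.single (Poly_Mapping.single i 1) 1"

definition poly_subst :: "(nat \<Rightarrow> 'a mpoly) \<Rightarrow> 'a mpoly \<Rightarrow> 'a :: comm_ring_1 mpoly" where
  "poly_subst \<sigma> f = (\<Sum>m\<in>Poly_Mapping.keys f. Poly_Mapping.single 0 (Poly_Mapping.lookup f m) *
      (\<Prod>v\<in>Poly_Mapping.keys m. \<sigma> v ^ Poly_Mapping.lookup m v))"

definition reflect :: "nat \<Rightarrow> 'a mpoly \<Rightarrow> 'a :: comm_ring_1 mpoly" where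
  "reflect i = poly_subst (if i = 0 then X(1 := - X 1) else X(i := X (i + 1), i + 1 := X i))"

definition ddiff_denom :: "nat \<Rightarrow> 'a :: comm_ring_1 mpoly" where
  "ddiff_denom i = (if i = 0 then - X 1 else X i - X (i + 1))"

text \<open>The quotient exists and is unique, see \<open>ddiff_unique\<close> below.\<close>

definition ddiff :: "nat \<Rightarrow> 'a mpoly \<Rightarrow> 'a :: idom mpoly" where
  "ddiff i f = (THE g. g * ddiff_denom i = f - reflect i f)"

text \<open>Operators act on what stands to their left, so the leftmost factor of the product, which is
  the head of the list of indices, is applied first.\<close>

definition nabla_B :: "nat \<Rightarrow> nat \<Rightarrow> 'a mpoly \<Rightarrow> 'a :: idom mpoly" where
  "nabla_B k n = fold ddiff (concat (map (\<lambda>j. [0..<n - j]) [0..<k]))"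

lemma mpoly_monom_decomp:
  "(f :: 'a :: comm_ring_1 mpoly) = (\<Sum>m\<in>Poly_Mapping.keys f. Poly_Mapping.single m (Poly_Mapping.lookup f m))"
  by (rule poly_mapping_eqI)
    (simp add: lookup_sum lookup_single when_def if_distrib sum.delta' in_keys_iff cong: if_cong)

lemma X_power: "X i ^ e = (Poly_Mapping.single (Poly_Mapping.single i e) 1 :: 'a :: comm_ring_1 mpoly)"
  by (induction e) (simp_all add: X_def mult_single flip: single_add)

lemma prod_X_power:
  "finite A \<Longrightarrow> (\<Prod>v\<in>A. X v ^ e v) =
    (Poly_Mapping.single (\<Sum>v\<in>A. Poly_Mapping.single v (e v)) 1 :: 'a :: comm_ring_1 mpoly)"
  by (induction A rule: finite_induct) (simp_all add: X_power mult_single)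

lemma poly_subst_X: "poly_subst X f = (f :: 'a :: comm_ring_1 mpoly)"
proof -
  have "(\<Sum>v\<in>Poly_Mapping.keys m. Poly_Mapping.single v (Poly_Mapping.lookup m v)) = m" for m :: "nat \<Rightarrow>\<^sub>0 nat"
    by (rule poly_mapping_eqI)
      (simp add: lookup_sum lookup_single when_def if_distrib sum.delta' in_keys_iff cong: if_cong)
  then have "poly_subst X f = (\<Sum>m\<in>Poly_Mapping.keys f. Poly_Mapping.single m (Poly_Mapping.lookup f m))"
    by (simp add: poly_subst_def prod_X_power mult_single)
  then show ?thesis using mpoly_monom_decomp[of f] by simp
qed

lemma dvd_prod_diff:
  fixes a b :: "'i \<Rightarrow> 'b :: comm_ring_1"
  assumes "finite A" "\<And>v. v \<in> A \<Longrightarrow> d dvd a v - b v"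
  shows "d dvd prod a A - prod b A"
  using assms
proof (induction A rule: finite_induct)
  case (insert v A)
  have "prod a (insert v A) - prod b (insert v A) =
      (a v - b v) * prod a A + b v * (prod a A - prod b A)"
    using insert by (simp add: algebra_simps)
  then show ?case using insert by simp
qed simp

lemma dvd_power_diff:
  fixes a b :: "'b :: comm_ring_1"
  assumes "d dvd a - b"
  shows "d dvd a ^ e - b ^ e"
  using dvd_prod_diff[of "{..<e}" d "\<lambda>_. a" "\<lambda>_. b"] assms by simp

lemma dvd_poly_subst_diff:
  fixes f :: "'a :: comm_ring_1 mpoly"
  assumes "\<And>v. d dvd \<sigma> v - \<tau> v"
  shows "d dvd poly_subst \<sigma> f - poly_subst \<tau> f"
  unfolding poly_subst_def sum_subtractf[symmetric] right_diff_distrib[symmetric]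
  by (intro dvd_sum dvd_mult dvd_prod_diff dvd_power_diff assms finite_keys)

lemma ddiff_denom_nonzero: "(ddiff_denom i :: 'a :: idom mpoly) \<noteq> 0"
proof
  assume "(ddiff_denom i :: 'a mpoly) = 0"
  then have "Poly_Mapping.lookup (ddiff_denom i :: 'a mpoly) (Poly_Mapping.single (if i = 0 then 1 else i) 1) = 0"
    by simp
  moreover have "Poly_Mapping.single (Suc i) (1::nat) \<noteq> Poly_Mapping.single i 1"
    by (metis lookup_single_eq lookup_single_not_eq n_not_Suc_n zero_neq_one)
  ultimately show False
    by (auto simp: ddiff_denom_def X_def lookup_minus lookup_single when_def split: if_splits)
qed

lemma ddiff_unique: "\<exists>!g. g * ddiff_denom i = f - reflect i (f :: 'a :: idom mpoly)"
proof -
  let ?\<sigma> = "if i = 0 then X(1 := - X 1) else X(i := X (i + 1), i + 1 := X i) :: nat \<Rightarrow> 'a mpoly"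
  have "ddiff_denom i dvd X v - ?\<sigma> v" for v
  proof (cases "i = 0")
    case True
    have "(X 1 :: 'a mpoly) dvd X 1 + X 1" by simp
    then show ?thesis using True by (simp add: ddiff_denom_def)
  next
    case False
    have "(X i - X (i + 1) :: 'a mpoly) dvd X (i + 1) - X i"
      by (metis dvd_minus_iff dvd_refl minus_diff_eq)
    then show ?thesis using False by (simp add: ddiff_denom_def)
  qed
  then have "ddiff_denom i dvd poly_subst X f - poly_subst ?\<sigma> f"
    by (rule dvd_poly_subst_diff)
  then obtain g where "g * ddiff_denom i = f - reflect i f"
    unfolding poly_subst_X reflect_def by (metis dvdE mult.commute)
  then show ?thesis
    using ddiff_denom_nonzero[of i, where ?'a = 'a] by (metis mult_right_cancel)
qed

lemma ddiff_mult_denom: "ddiff i f * ddiff_denom i = f - reflect i (f :: 'a :: idom mpoly)"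
  unfolding ddiff_def by (rule theI'[OF ddiff_unique])

section \<open>Schur polynomials\<close>

text \<open>The classical quotient of alternants
  $\det(x_i^{\mu_j+k-j})_{1\le i,j\le k} / \det(x_i^{k-j})_{1\le i,j\le k}$, for a partition
  \<open>mu\<close> given as a weakly decreasing list of length \<open>k\<close>. The quotient exists because
  an alternant is divisible by the Vandermonde determinant, and is unique because polynomials form
  a domain.\<close>

definition alternant :: "nat \<Rightarrow> (nat \<Rightarrow> nat) \<Rightarrow> 'a :: comm_ring_1 mpoly" where
  "alternant k a = det (mat k k (\<lambda>(i, j). X (i + 1) ^ a j))"

definition schur :: "nat \<Rightarrow> nat list \<Rightarrow> 'a :: idom mpoly" where
  "schur k mu = (THE s. s * alternant k (\<lambda>j. k - 1 - j) = alternant k (\<lambda>j. mu ! j + (k - 1 - j)))"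

section \<open>Q-tilde polynomials\<close>

definition elem_sym :: "nat \<Rightarrow> nat \<Rightarrow> 'a :: comm_ring_1 mpoly" where
  "elem_sym n i = (\<Sum>S | S \<subseteq> {1..n} \<and> card S = i. \<Prod>v\<in>S. X v)"

definition Qt2 :: "nat \<Rightarrow> nat \<Rightarrow> nat \<Rightarrow> 'a :: comm_ring_1 mpoly" where
  "Qt2 n i j = elem_sym n i * elem_sym n j +
     2 * (\<Sum>p = 1..j. (-1) ^ p * elem_sym n (i + p) * elem_sym n (j - p))"

text \<open>The Pfaffian of a skew-symmetric matrix of even dimension $2h$, as the signed sum over the
  perfect matchings of the index set; each matching
  $\{\{\pi(0),\pi(1)\},\ldots,\{\pi(2h-2),\pi(2h-1)\}\}$ is represented by the unique permutation
  with $\pi(2i)<\pi(2i+1)$ and $\pi(0)<\pi(2)<\cdots$.\<close>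

definition pfaffian :: "'a :: comm_ring_1 mat \<Rightarrow> 'a" where
  "pfaffian A = (let h = dim_row A div 2 in
     \<Sum>\<pi> | \<pi> permutes {0..<dim_row A} \<and> (\<forall>i<h. \<pi> (2 * i) < \<pi> (2 * i + 1)) \<and>
           (\<forall>i j. i < j \<and> j < h \<longrightarrow> \<pi> (2 * i) < \<pi> (2 * j)).
       signof \<pi> * (\<Prod>i<h. A $$ (\<pi> (2 * i), \<pi> (2 * i + 1))))"

definition Qt :: "nat \<Rightarrow> nat list \<Rightarrow> 'a :: comm_ring_1 mpoly" where
  "Qt n I = (let I' = (if even (length I) then I else I @ [0]); m = length I' in
     pfaffian (mat m m (\<lambda>(p, q).
       if p < q then Qt2 n (I' ! p) (I' ! q)
       else if q < p then - Qt2 n (I' ! q) (I' ! p)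
       else 0)))"

section \<open>Partitions\<close>

text \<open>Strict partitions are the lists of their nonzero parts in decreasing order, so that
  \<open>length\<close> is the number of nonzero parts.\<close>

definition strict_partition :: "nat list \<Rightarrow> bool" where
  "strict_partition I \<longleftrightarrow> sorted_wrt (>) I \<and> 0 \<notin> set I"

definition partition_le :: "nat list \<Rightarrow> nat list \<Rightarrow> bool" where
  "partition_le I J \<longleftrightarrow> (\<forall>p. nth_default 0 I p \<le> nth_default 0 J p)"

definition rho :: "nat \<Rightarrow> nat list" where
  "rho n = rev [1..<Suc n]"

text \<open>The integers $n-0-\alpha_1,\ldots,n-(k-2)-\alpha_{k-1}$; the list index \<open>j\<close> starts at 0.\<close>

definition erased :: "nat \<Rightarrow> nat \<Rightarrow> nat list \<Rightarrow> int set" where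
  "erased n k \<alpha> = (\<lambda>j. int n - int j - int (\<alpha> ! j)) ` {0..<k - 1}"

definition remaining_parts :: "int set \<Rightarrow> nat list \<Rightarrow> nat list" where
  "remaining_parts E I = filter (\<lambda>i. int i \<notin> E) I"

definition position_sum :: "int set \<Rightarrow> nat list \<Rightarrow> nat" where
  "position_sum E I = (\<Sum>p | 1 \<le> p \<and> p \<le> length I \<and> int (I ! (p - 1)) \<in> E. p)"

end

theory Submission
  imports Defs
begin

text \<open>Write $\sigma = \partial_0 \partial_1 \cdots \partial_{n-1}$. The braid relations give
  $\sigma^k = \partial_{w} \nabla_k^B(n)$ with $w$ the longest permutation of $x_1,\ldots,x_k$, and
  $Y_\alpha$ is the image of a monomial $x_1^{b_1} \cdots x_k^{b_k}$ under $\partial_w$, where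
  $n = b_1 > b_2 > \cdots > b_k$. As $b_2,\ldots,b_k < n$, the powers of $x_2,\ldots,x_k$ can be
  moved through $\sigma^k$: all correction terms are killed because $\partial_i \sigma^j = 0$ for
  $i < j$. Hence $F\,Y_\alpha \nabla_k^B(n)$, for $F$ symmetric, results from $F$ by applying
  successively $D_b : F \mapsto F x_1^b \sigma$ for $b = b_1,\ldots,b_k$.

  The reflection $x_1 \mapsto -x_1$ changes the Pfaffian matrix of $\widetilde Q_I$ by a matrix of rank
  two, so that $D_b \widetilde Q_I$ is an alternating sum of Q-tilde polynomials with one part of $I$
  removed. It turns out that $D_n$ multiplies $\widetilde Q_I$ by $-2$ or $0$, according to the parities
  of $\ell(I)$ and $n$, while for $b < n$ the operator $D_b$ removes the part $n - b$, with factor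
  $2 (-1)^n$ and the sign of its position, and kills $\widetilde Q_I$ if this part does not occur.\<close>

section \<open>Substitution\<close>

text \<open>The exponents \<open>b_i = \<alpha>_(k+1-i) + k - i\<close> strictly decrease because
  \<alpha> weakly increases, and \<open>\<alpha>_k = n - k + 1\<close> makes the first one equal to
  n. It is the only exponent too large to be moved through \<sigma>, and it sits on
  \<open>x_1\<close>, where no move is required. A correction term of a move contains two powers. If
  the one subjected to \<open>\<partial>_(j+1) ... \<partial>_(n-1)\<close> survives, its exponent
  is at least n - 1 - j; as b < n, the complementary power of \<open>x_j\<close> then has exponent
  below j and dies under the transposed word \<open>\<partial>_(j-1) ... \<partial>_0\<close>.
  Erasing the part at position p contributes 2 (-1)^n (-1)^(p-1). Decreasing b means increasing
  parts n - b, so I is erased from right to left and the parts still to be erased keep their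
  positions. The k - 1 removals give 2^(k-1) (-1)^((k-1)(n+1)+s), and \<open>D_n\<close> supplies
  the factor -2. Pfaffians are treated by their first row recursion on index lists: signed removal
  of an entry is a contraction as in the exterior algebra, and anticommutation of contractions
  replaces row and column operations.\<close>

abbreviation Const :: "'a \<Rightarrow> 'a :: comm_ring_1 mpoly" where
  "Const c \<equiv> Poly_Mapping.single 0 c"

text \<open>By \<open>poly_subst_X\<close>, a polynomial is literally a finite sum of products of
  constants and powers of variables. With this rule the relations between reflections only have to
  be checked on variables.\<close>

lemma mpoly_induct [case_names const var add mult]:
  fixes f :: "'a :: comm_ring_1 mpoly"
  assumes "\<And>c. P (Const c)" "\<And>i. P (X i)"
    and add: "\<And>f g. P f \<Longrightarrow> P g \<Longrightarrow> P (f + g)" and mult: "\<And>f g. P f \<Longrightarrow> P g \<Longrightarrow> P (f * g)"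
  shows "P f"
proof -
  have P0: "P 0" and P1: "P 1" using assms(1)[of 0] assms(1)[of 1] by simp_all
  have psum: "finite A \<Longrightarrow> (\<And>x. x \<in> A \<Longrightarrow> P (h x)) \<Longrightarrow> P (sum h A)" for A and h :: "'b \<Rightarrow> 'a mpoly"
    by (induction A rule: finite_induct) (auto intro: P0 add)
  have pprod: "finite A \<Longrightarrow> (\<And>x. x \<in> A \<Longrightarrow> P (h x)) \<Longrightarrow> P (prod h A)" for A and h :: "nat \<Rightarrow> 'a mpoly"
    by (induction A rule: finite_induct) (auto intro: P1 mult)
  have ppow: "P h \<Longrightarrow> P (h ^ e)" for h :: "'a mpoly" and e
    by (induction e) (auto intro: P1 mult)
  have "P (poly_subst X f)"
    unfolding poly_subst_def by (intro psum pprod mult ppow assms finite_keys)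
  then show ?thesis by (simp add: poly_subst_X)
qed

text \<open>Cancellation may shrink the support of a sum, so additivity is proved by summing over a
  common superset of the supports.\<close>

lemma poly_subst_superset:
  assumes "finite A" "Poly_Mapping.keys f \<subseteq> A"
  shows "poly_subst \<sigma> f = (\<Sum>m\<in>A. Const (Poly_Mapping.lookup f m) *
      (\<Prod>v\<in>Poly_Mapping.keys m. \<sigma> v ^ Poly_Mapping.lookup m v))"
  unfolding poly_subst_def using assms by (intro sum.mono_neutral_left) (auto simp: in_keys_iff)

lemma poly_subst_add: "poly_subst \<sigma> (f + g) = poly_subst \<sigma> f + poly_subst \<sigma> g"
proof -
  let ?A = "Poly_Mapping.keys f \<union> Poly_Mapping.keys g"
  have "Poly_Mapping.keys (f + g) \<subseteq> ?A" by (rule keys_add)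
  then show ?thesis
    by (simp add: poly_subst_superset[of ?A] lookup_add single_add distrib_right sum.distrib)
qed

lemma poly_subst_single:
  "poly_subst \<sigma> (Poly_Mapping.single m c) =
    Const c * (\<Prod>v\<in>Poly_Mapping.keys m. \<sigma> v ^ Poly_Mapping.lookup m v)"
  by (cases "c = 0") (simp_all add: poly_subst_def)

lemma prod_keys_superset:
  assumes "finite A" "Poly_Mapping.keys m \<subseteq> A"
  shows "(\<Prod>v\<in>Poly_Mapping.keys m. \<sigma> v ^ Poly_Mapping.lookup m v) =
    (\<Prod>v\<in>A. (\<sigma> v :: 'a :: comm_ring_1) ^ Poly_Mapping.lookup m v)"
  using assms by (intro prod.mono_neutral_left) (auto simp: in_keys_iff)

lemma poly_subst_single_mult:
  "poly_subst \<sigma> (Poly_Mapping.single m c * Poly_Mapping.single l d) =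
   poly_subst \<sigma> (Poly_Mapping.single m c) * poly_subst \<sigma> (Poly_Mapping.single l d)"
proof -
  let ?A = "Poly_Mapping.keys m \<union> Poly_Mapping.keys l"
  have 1: "(\<Prod>v\<in>Poly_Mapping.keys (m + l). \<sigma> v ^ Poly_Mapping.lookup (m + l) v) =
      (\<Prod>v\<in>?A. \<sigma> v ^ Poly_Mapping.lookup m v) * (\<Prod>v\<in>?A. \<sigma> v ^ Poly_Mapping.lookup l v)"
    by (subst prod_keys_superset[of ?A]) (simp_all add: keys_add lookup_add power_add prod.distrib)
  have 2: "Const (c * d) = Const c * Const d" by (simp add: mult_single)
  show ?thesis
    unfolding mult_single[of m c l d] poly_subst_single 1 2
    by (simp add: prod_keys_superset[of ?A m] prod_keys_superset[of ?A l] mult_ac)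
qed

lemma poly_subst_0 [simp]: "poly_subst \<sigma> 0 = 0"
  by (simp add: poly_subst_def)

lemma poly_subst_sum: "poly_subst \<sigma> (sum h A) = (\<Sum>x\<in>A. poly_subst \<sigma> (h x))"
  by (induction A rule: infinite_finite_induct) (simp_all add: poly_subst_add)

lemma poly_subst_mult: "poly_subst \<sigma> (f * g) = poly_subst \<sigma> f * poly_subst \<sigma> g"
proof -
  let ?s = "\<lambda>f m. Poly_Mapping.single m (Poly_Mapping.lookup f m)"
  have "poly_subst \<sigma> (f * g) = poly_subst \<sigma> (sum (?s f) (Poly_Mapping.keys f) * sum (?s g) (Poly_Mapping.keys g))"
    by (simp flip: mpoly_monom_decomp)
  also have "\<dots> = poly_subst \<sigma> (sum (?s f) (Poly_Mapping.keys f)) * poly_subst \<sigma> (sum (?s g) (Poly_Mapping.keys g))"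
    by (simp add: sum_product poly_subst_sum poly_subst_single_mult)
  finally show ?thesis by (simp flip: mpoly_monom_decomp)
qed

lemma poly_subst_Const [simp]: "poly_subst \<sigma> (Const c) = Const c"
  by (simp add: poly_subst_single)

lemma poly_subst_var [simp]: "poly_subst \<sigma> (X i) = (\<sigma> i :: 'a :: comm_ring_1 mpoly)"
  by (simp add: X_def poly_subst_single)

lemma poly_subst_1 [simp]: "poly_subst \<sigma> 1 = 1"
  using poly_subst_Const[of \<sigma> 1] by simp

lemma poly_subst_minus: "poly_subst \<sigma> (- f) = - poly_subst \<sigma> f"
  using poly_subst_add[of \<sigma> f "- f"] by (simp add: eq_neg_iff_add_eq_0 add.commute)

lemma poly_subst_diff: "poly_subst \<sigma> (f - g) = poly_subst \<sigma> f - poly_subst \<sigma> g"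
  using poly_subst_add[of \<sigma> f "- g"] by (simp add: poly_subst_minus)

lemma poly_subst_power: "poly_subst \<sigma> (f ^ e) = poly_subst \<sigma> f ^ e"
  by (induction e) (simp_all add: poly_subst_mult)

lemma poly_subst_prod: "poly_subst \<sigma> (prod h A) = (\<Prod>x\<in>A. poly_subst \<sigma> (h x))"
  by (induction A rule: infinite_finite_induct) (simp_all add: poly_subst_mult)

lemma poly_subst_poly_subst: "poly_subst \<sigma> (poly_subst \<tau> f) = poly_subst (\<lambda>i. poly_subst \<sigma> (\<tau> i)) f"
  by (induction f rule: mpoly_induct) (simp_all add: poly_subst_add poly_subst_mult)

section \<open>Reflections: homomorphism rules and Coxeter relations of type B\<close>

lemma reflect_add [simp]: "reflect i (f + g) = reflect i f + reflect i g"
  and reflect_diff [simp]: "reflect i (f - g) = reflect i f - reflect i g"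
  and reflect_minus [simp]: "reflect i (- f) = - reflect i f"
  and reflect_mult [simp]: "reflect i (f * g) = reflect i f * reflect i g"
  and reflect_power [simp]: "reflect i (f ^ e) = reflect i f ^ e"
  and reflect_Const [simp]: "reflect i (Const c) = Const c"
  and reflect_0 [simp]: "reflect i 0 = 0"
  and reflect_1 [simp]: "reflect i 1 = 1"
  by (simp_all add: reflect_def poly_subst_add poly_subst_diff poly_subst_minus poly_subst_mult poly_subst_power)

lemma reflect_sum: "reflect i (sum h A) = (\<Sum>x\<in>A. reflect i (h x))"
  and reflect_prod: "reflect i (prod h A) = (\<Prod>x\<in>A. reflect i (h x))"
  by (simp_all add: reflect_def poly_subst_sum poly_subst_prod)

lemma reflect_of_nat [simp]: "reflect i (of_nat m) = of_nat m"
  by (induction m) simp_all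

lemma reflect_numeral [simp]: "reflect i (numeral m) = numeral m"
  using reflect_of_nat[of i "numeral m"] by simp

lemma reflect_X: "reflect i (X v) =
  (if i = 0 then if v = 1 then - X 1 else X v
   else if v = i then X (Suc i) else if v = Suc i then X i else X v)"
  by (simp add: reflect_def)

lemma reflect_reflect [simp]: "reflect i (reflect i f) = f"
  by (induction f rule: mpoly_induct) (simp_all add: reflect_X)

lemma reflect_commute:
  assumes "Suc i < j"
  shows "reflect i (reflect j f) = reflect j (reflect i f)"
  using assms by (induction f rule: mpoly_induct) (auto simp: reflect_X)

lemma reflect_braid:
  assumes "0 < i"
  shows "reflect i (reflect (Suc i) (reflect i f)) = reflect (Suc i) (reflect i (reflect (Suc i) f))"
  using assms by (induction f rule: mpoly_induct) (auto simp: reflect_X)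

lemma reflect_braid_0:
  "reflect 0 (reflect (Suc 0) (reflect 0 (reflect (Suc 0) f))) =
   reflect (Suc 0) (reflect 0 (reflect (Suc 0) (reflect 0 f)))"
  by (induction f rule: mpoly_induct) (auto simp: reflect_X)

lemma reflect_denom: "reflect i (ddiff_denom i) = - ddiff_denom i"
  by (auto simp: ddiff_denom_def reflect_X)

section \<open>Divided differences\<close>

lemma ddiff_eqI:
  fixes f :: "'a :: idom mpoly"
  assumes "g * ddiff_denom i = f - reflect i f"
  shows "ddiff i f = g"
  using assms ddiff_mult_denom[of i f] ddiff_denom_nonzero[of i, where ?'a = 'a]
  by (metis mult_right_cancel)

lemma ddiff_add: "ddiff i (f + g) = ddiff i f + ddiff i (g :: 'a :: idom mpoly)"
  by (rule ddiff_eqI) (simp add: distrib_right ddiff_mult_denom)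

lemma ddiff_minus: "ddiff i (- f) = - ddiff i (f :: 'a :: idom mpoly)"
  by (rule ddiff_eqI) (simp add: ddiff_mult_denom)

lemma ddiff_diff: "ddiff i (f - g) = ddiff i f - ddiff i (g :: 'a :: idom mpoly)"
  by (rule ddiff_eqI) (simp add: left_diff_distrib ddiff_mult_denom)

text \<open>The twisted Leibniz rule, with the reflection on the second factor; factors fixed by the
  reflection are scalars for \<open>ddiff i\<close>.\<close>

lemma ddiff_mult: "ddiff i (f * g) = f * ddiff i g + ddiff i f * reflect i (g :: 'a :: idom mpoly)"
proof (rule ddiff_eqI)
  have "(f * ddiff i g + ddiff i f * reflect i g) * ddiff_denom i =
      f * (ddiff i g * ddiff_denom i) + (ddiff i f * ddiff_denom i) * reflect i g"
    by (simp add: algebra_simps)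
  also have "\<dots> = f * g - reflect i (f * g)"
    unfolding ddiff_mult_denom by (simp add: algebra_simps)
  finally show "(f * ddiff i g + ddiff i f * reflect i g) * ddiff_denom i = f * g - reflect i (f * g)" .
qed

lemma reflect_ddiff [simp]: "reflect i (ddiff i f) = ddiff i (f :: 'a :: idom mpoly)"
proof (rule sym, rule ddiff_eqI)
  show "reflect i (ddiff i f) * ddiff_denom i = f - reflect i f"
    using arg_cong[OF ddiff_mult_denom[of i f], of "reflect i"]
    by (simp add: reflect_denom) (metis minus_diff_eq minus_minus)
qed

lemma ddiff_eq_0_iff: "ddiff i f = 0 \<longleftrightarrow> reflect i f = (f :: 'a :: idom mpoly)"
  using ddiff_mult_denom[of i f] ddiff_denom_nonzero[of i, where ?'a = 'a] by auto

lemma ddiff_0 [simp]: "ddiff i (0 :: 'a :: idom mpoly) = 0"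
  and ddiff_ddiff [simp]: "ddiff i (ddiff i f :: 'a mpoly) = 0"
  by (simp_all add: ddiff_eq_0_iff)

lemma ddiff_reflect: "ddiff i (reflect i f) = - ddiff i (f :: 'a :: idom mpoly)"
  by (rule ddiff_eqI) (simp add: ddiff_mult_denom)

lemma ddiff_mult_invariant_left:
  "reflect i c = c \<Longrightarrow> ddiff i (c * f) = c * ddiff i (f :: 'a :: idom mpoly)"
  by (simp add: ddiff_mult ddiff_eq_0_iff[THEN iffD2])

lemma ddiff_mult_invariant_right:
  "reflect i c = c \<Longrightarrow> ddiff i (f * c) = ddiff i (f :: 'a :: idom mpoly) * c"
  using ddiff_mult_invariant_left[of i c f] by (simp add: mult.commute)

lemma ddiff_denom_inert:
  "Suc i < j \<Longrightarrow> reflect i (ddiff_denom j) = ddiff_denom j"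
  "Suc i < j \<Longrightarrow> reflect j (ddiff_denom i) = ddiff_denom i"
  by (auto simp: ddiff_denom_def reflect_X)

lemma reflect_ddiff_commute:
  fixes f :: "'a :: idom mpoly"
  assumes "Suc i < j \<or> Suc j < i"
  shows "reflect i (ddiff j f) = ddiff j (reflect i f)"
proof (rule sym, rule ddiff_eqI)
  have *: "reflect i (ddiff_denom j :: 'a mpoly) = ddiff_denom j"
    and **: "reflect i (reflect j f) = reflect j (reflect i f)"
    using assms by (auto simp: ddiff_denom_inert reflect_commute[of i j] reflect_commute[of j i])
  show "reflect i (ddiff j f) * ddiff_denom j = reflect i f - reflect j (reflect i f)"
    using arg_cong[OF ddiff_mult_denom[of j f], of "reflect i"] by (simp add: * **)
qed

lemma ddiff_commute:
  fixes f :: "'a :: idom mpoly"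
  assumes "Suc i < j \<or> Suc j < i"
  shows "ddiff i (ddiff j f) = ddiff j (ddiff i f)"
proof (rule ddiff_eqI)
  have *: "reflect j (ddiff_denom i :: 'a mpoly) = ddiff_denom i"
    using assms by (auto simp: ddiff_denom_inert)
  have "ddiff j (ddiff i f) * ddiff_denom i = ddiff j (ddiff i f * ddiff_denom i)"
    by (simp add: ddiff_mult_invariant_right *)
  also have "\<dots> = ddiff j f - reflect i (ddiff j f)"
    using assms by (simp add: ddiff_mult_denom ddiff_diff reflect_ddiff_commute)
  finally show "ddiff j (ddiff i f) * ddiff_denom i = ddiff j f - reflect i (ddiff j f)" .
qed

text \<open>Both words of each braid relation turn \<open>f\<close> into the antisymmetrization of \<open>f\<close> over the dihedral
  group divided by the product of all positive roots.\<close>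

lemma ddiff_braid:
  fixes f :: "'a :: idom mpoly"
  assumes "0 < i"
  shows "ddiff i (ddiff (Suc i) (ddiff i f)) = ddiff (Suc i) (ddiff i (ddiff (Suc i) f))"
proof -
  define s t where "s = (reflect i :: 'a mpoly \<Rightarrow> _)" and "t = (reflect (Suc i) :: 'a mpoly \<Rightarrow> _)"
  define D E where "D = (ddiff i :: 'a mpoly \<Rightarrow> _)" and "E = (ddiff (Suc i) :: 'a mpoly \<Rightarrow> _)"
  define a b c :: "'a mpoly" where "a = ddiff_denom i" and "b = ddiff_denom (Suc i)" and "c = a + b"
  have hom: "s (x * y) = s x * s y" "s (x - y) = s x - s y" "s (s x) = x" "s (- x) = - s x" 
    "t (x * y) = t x * t y" "t (x - y) = t x - t y" "t (t x) = x" "t (- x) = - t x" for x y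
    by (simp_all add: s_def t_def)
  have roots: "s a = - a" "s b = c" "s c = b" "t a = c" "t b = - b" "t c = a"
    using assms by (auto simp: s_def t_def a_def b_def c_def ddiff_denom_def reflect_X)
  have D: "D x * a = x - s x" and E: "E x * b = x - t x" for x
    by (simp_all add: D_def E_def a_def b_def s_def t_def ddiff_mult_denom)
  have nz: "a \<noteq> 0" "b \<noteq> 0" "c \<noteq> 0"
    using ddiff_denom_nonzero[where ?'a = 'a] roots(3) unfolding a_def b_def
    by (auto simp: s_def)
  have 1: "D (E (D f)) * (a * b * c) = f - s f - t f + s (t f) + t (s f) - s (t (s f))"
  proof -
    \<comment> \<open>Applying \<open>t\<close> to the defining equation of \<open>D f\<close> turns
      its denominator \<open>a\<close> into \<open>c\<close>. Likewise \<open>e2\<close> is the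
      image of \<open>e1\<close> under \<open>s\<close>, so all terms acquire a common
      denominator.\<close>
    have e0: "t (D f) * c = t f - t (s f)"
      using arg_cong[OF D[of f], of t] by (simp only: hom roots)
    have "E (D f) * b * a * c = (D f * a) * c - (t (D f) * c) * a"
      unfolding E[of "D f"] by (simp add: algebra_simps)
    then have e1: "E (D f) * b * a * c = c * (f - s f) - a * (t f - t (s f))"
      unfolding D[of f] e0 by (simp only: mult.commute)
    have e2: "s (E (D f)) * c * (- a) * b = b * (s f - f) + a * (s (t f) - s (t (s f)))"
      using arg_cong[OF e1, of s] unfolding hom roots by (simp add: algebra_simps)
    have "D (E (D f)) * (a * b * c) * a = (E (D f) - s (E (D f))) * (a * b * c)"
      by (simp add: mult_ac flip: D)
    also have "\<dots> = E (D f) * b * a * c + s (E (D f)) * c * (- a) * b"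
      by (simp add: algebra_simps)
    also have "\<dots> = (f - s f - t f + s (t f) + t (s f) - s (t (s f))) * a"
      unfolding e1 e2 by (simp add: c_def algebra_simps)
    finally show ?thesis using nz by simp
  qed
  have 2: "E (D (E f)) * (a * b * c) = f - s f - t f + s (t f) + t (s f) - t (s (t f))"
  proof -
    have e0: "s (E f) * c = s f - s (t f)"
      using arg_cong[OF E[of f], of s] by (simp only: hom roots)
    have "D (E f) * a * b * c = (E f * b) * c - (s (E f) * c) * b"
      unfolding D[of "E f"] by (simp add: algebra_simps)
    then have e1: "D (E f) * a * b * c = c * (f - t f) - b * (s f - s (t f))"
      unfolding E[of f] e0 by (simp only: mult.commute)
    have e2: "t (D (E f)) * c * (- b) * a = a * (t f - f) + b * (t (s f) - t (s (t f)))"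
      using arg_cong[OF e1, of t] unfolding hom roots by (simp add: algebra_simps)
    have "E (D (E f)) * (a * b * c) * b = (D (E f) - t (D (E f))) * (a * b * c)"
      by (simp add: mult_ac flip: E)
    also have "\<dots> = D (E f) * a * b * c + t (D (E f)) * c * (- b) * a"
      by (simp add: algebra_simps)
    also have "\<dots> = (f - s f - t f + s (t f) + t (s f) - t (s (t f))) * b"
      unfolding e1 e2 by (simp add: c_def algebra_simps)
    finally show ?thesis using nz by simp
  qed
  have "s (t (s f)) = t (s (t f))"
    using reflect_braid[OF assms] by (simp add: s_def t_def)
  then have "D (E (D f)) * (a * b * c) = E (D (E f)) * (a * b * c)"
    unfolding 1 2 by simp
  then have "D (E (D f)) = E (D (E f))"
    using nz by simp
  then show ?thesis by (simp add: D_def E_def)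
qed

lemma ddiff_braid_0:
  fixes f :: "'a :: idom mpoly"
  shows "ddiff 0 (ddiff (Suc 0) (ddiff 0 (ddiff (Suc 0) f))) = ddiff (Suc 0) (ddiff 0 (ddiff (Suc 0) (ddiff 0 f)))"
proof -
  define s t where "s = (reflect 0 :: 'a mpoly \<Rightarrow> _)" and "t = (reflect (Suc 0) :: 'a mpoly \<Rightarrow> _)"
  define D E where "D = (ddiff 0 :: 'a mpoly \<Rightarrow> _)" and "E = (ddiff (Suc 0) :: 'a mpoly \<Rightarrow> _)"
  \<comment> \<open>These are the positive roots of type B2: -\<open>x_1\<close>,
    \<open>x_1 - x_2\<close>, -\<open>x_1\<close> - \<open>x_2\<close> and -\<open>x_2\<close>. The
    reflection \<open>s\<close> negates \<open>a\<close>, exchanges \<open>b\<close> and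
    \<open>c\<close>, and fixes \<open>d\<close>; \<open>t\<close> negates \<open>b\<close>,
    exchanges \<open>a\<close> and \<open>d\<close>, and fixes \<open>c\<close>.\<close>
  define a b c d :: "'a mpoly"
    where "a = ddiff_denom 0" and "b = ddiff_denom (Suc 0)" and "c = 2 * a + b" and "d = a + b"
  have hom: "s (x * y) = s x * s y" "s (x - y) = s x - s y" "s (s x) = x" "s (- x) = - s x" "s (x + y) = s x + s y"
    "t (x * y) = t x * t y" "t (x - y) = t x - t y" "t (t x) = x" "t (- x) = - t x" "t (x + y) = t x + t y" for x y
    by (simp_all add: s_def t_def)
  have roots: "s a = - a" "s b = c" "s c = b" "s d = d" "t a = d" "t b = - b" "t c = c" "t d = a"
    by (auto simp: s_def t_def a_def b_def c_def d_def ddiff_denom_def reflect_X)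
  have D: "D x * a = x - s x" and E: "E x * b = x - t x" for x
    by (simp_all add: D_def E_def a_def b_def s_def t_def ddiff_mult_denom)
  have nz: "a \<noteq> 0" "b \<noteq> 0" "c \<noteq> 0" "d \<noteq> 0"
    using ddiff_denom_nonzero[where ?'a = 'a] roots(3,8) unfolding a_def b_def
    by (auto simp: s_def t_def)
  have 1: "E (D (E (D f))) * (a * b * c * d) = f - s f - t f + t (s f) + s (t f) - s (t (s f)) - t (s (t f)) + t (s (t (s f)))"
  proof -
    have e0: "t (D f) * d = t f - t (s f)"
      using arg_cong[OF D[of f], of t] by (simp only: hom roots)
    have "E (D f) * b * a * d = (D f * a) * d - (t (D f) * d) * a"
      unfolding E[of "D f"] by (simp add: algebra_simps)
    then have e1: "E (D f) * b * a * d = d * (f - s f) - a * (t f - t (s f))"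
      unfolding D[of f] e0 by (simp only: mult.commute)
    have e2: "s (E (D f)) * c * (- a) * d = d * (s f - f) + a * (s (t f) - s (t (s f)))"
      using arg_cong[OF e1, of s] unfolding hom roots by (simp add: algebra_simps)
    have "D (E (D f)) * (a * b * c * d) * a = (E (D f) - s (E (D f))) * (a * b * c * d)"
      by (simp add: mult_ac flip: D)
    also have "\<dots> = E (D f) * b * a * d * c + s (E (D f)) * c * (- a) * d * b"
      by (simp add: algebra_simps)
    \<comment> \<open>The coefficient \<open>2 * d\<close> comes from c - b = 2 a, after the factor
      \<open>a\<close> is split off.\<close>
    also have "\<dots> = (2 * d * (f - s f) - c * (t f - t (s f)) + b * (s (t f) - s (t (s f)))) * a"
      unfolding e1 e2 by (simp add: c_def d_def algebra_simps)
    finally have e3: "D (E (D f)) * (a * b * c * d) = 2 * d * (f - s f) - c * (t f - t (s f)) + b * (s (t f) - s (t (s f)))"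
      using nz by simp
    have two: "t 2 = 2" by (simp add: t_def)
    have e4: "t (D (E (D f))) * (d * (- b) * c * a) =
        2 * a * (t f - t (s f)) - c * (f - s f) - b * (t (s (t f)) - t (s (t (s f))))"
      using arg_cong[OF e3, of t] unfolding hom roots two by (simp add: algebra_simps)
    have "E (D (E (D f))) * (a * b * c * d) * b = (D (E (D f)) - t (D (E (D f)))) * (a * b * c * d)"
      by (simp add: mult_ac flip: E)
    also have "\<dots> = D (E (D f)) * (a * b * c * d) + t (D (E (D f))) * (d * (- b) * c * a)"
      by (simp add: algebra_simps)
    also have "\<dots> = (f - s f - t f + t (s f) + s (t f) - s (t (s f)) - t (s (t f)) + t (s (t (s f)))) * b"
      unfolding e3 e4 by (simp add: c_def d_def algebra_simps)
    finally show ?thesis using nz by simp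
  qed
  have 2: "D (E (D (E f))) * (a * b * c * d) = f - s f - t f + t (s f) + s (t f) - s (t (s f)) - t (s (t f)) + s (t (s (t f)))"
  proof -
    have e0: "s (E f) * c = s f - s (t f)"
      using arg_cong[OF E[of f], of s] by (simp only: hom roots)
    have "D (E f) * a * b * c = (E f * b) * c - (s (E f) * c) * b"
      unfolding D[of "E f"] by (simp add: algebra_simps)
    then have e1: "D (E f) * a * b * c = c * (f - t f) - b * (s f - s (t f))"
      unfolding E[of f] e0 by (simp only: mult.commute)
    have e2: "t (D (E f)) * d * (- b) * c = c * (t f - f) + b * (t (s f) - t (s (t f)))"
      using arg_cong[OF e1, of t] unfolding hom roots by (simp add: algebra_simps)
    have "E (D (E f)) * (a * b * c * d) * b = (D (E f) - t (D (E f))) * (a * b * c * d)"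
      by (simp add: mult_ac flip: E)
    also have "\<dots> = D (E f) * a * b * c * d + t (D (E f)) * d * (- b) * c * a"
      by (simp add: algebra_simps)
    also have "\<dots> = (c * (f - t f) - d * (s f - s (t f)) + a * (t (s f) - t (s (t f)))) * b"
      unfolding e1 e2 by (simp add: c_def d_def algebra_simps)
    finally have e3: "E (D (E f)) * (a * b * c * d) = c * (f - t f) - d * (s f - s (t f)) + a * (t (s f) - t (s (t f)))"
      using nz by simp
    have e4: "s (E (D (E f))) * ((- a) * c * b * d) =
        b * (s f - s (t f)) - d * (f - t f) - a * (s (t (s f)) - s (t (s (t f))))"
      using arg_cong[OF e3, of s] unfolding hom roots by (simp add: algebra_simps)
    have "D (E (D (E f))) * (a * b * c * d) * a = (E (D (E f)) - s (E (D (E f)))) * (a * b * c * d)"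
      by (simp add: mult_ac flip: D)
    also have "\<dots> = E (D (E f)) * (a * b * c * d) + s (E (D (E f))) * ((- a) * c * b * d)"
      by (simp add: algebra_simps)
    also have "\<dots> = (f - s f - t f + t (s f) + s (t f) - s (t (s f)) - t (s (t f)) + s (t (s (t f)))) * a"
      unfolding e3 e4 by (simp add: c_def d_def algebra_simps)
    finally show ?thesis using nz by simp
  qed
  have "s (t (s (t f))) = t (s (t (s f)))"
    using reflect_braid_0 by (simp add: s_def t_def)
  then have "E (D (E (D f))) * (a * b * c * d) = D (E (D (E f))) * (a * b * c * d)"
    unfolding 1 2 by simp
  then have "E (D (E (D f))) = D (E (D (E f)))"
    using nz by simp
  then show ?thesis by (simp add: D_def E_def)
qed

section \<open>Words of divided differences\<close>

lemma fold_ddiff_add: "fold ddiff ws (f + g) = fold ddiff ws f + fold ddiff ws (g :: 'a :: idom mpoly)"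
  by (induction ws arbitrary: f g) (simp_all add: ddiff_add)

lemma fold_ddiff_minus: "fold ddiff ws (- f) = - fold ddiff ws (f :: 'a :: idom mpoly)"
  by (induction ws arbitrary: f) (simp_all add: ddiff_minus)

lemma fold_ddiff_diff: "fold ddiff ws (f - g) = fold ddiff ws f - fold ddiff ws (g :: 'a :: idom mpoly)"
  by (induction ws arbitrary: f g) (simp_all add: ddiff_diff)

lemma fold_ddiff_0 [simp]: "fold ddiff ws (0 :: 'a :: idom mpoly) = 0"
  by (induction ws) simp_all

lemma fold_ddiff_sum: "fold ddiff ws (sum h A) = (\<Sum>x\<in>A. fold ddiff ws (h x :: 'a :: idom mpoly))"
  by (induction A rule: infinite_finite_induct) (simp_all add: fold_ddiff_add)

lemma fold_ddiff_mult_invariant: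
  assumes "\<And>i. i \<in> set ws \<Longrightarrow> reflect i c = c"
  shows "fold ddiff ws (c * f) = c * fold ddiff ws (f :: 'a :: idom mpoly)"
  using assms by (induction ws arbitrary: f) (simp_all add: ddiff_mult_invariant_left)

lemma fold_ddiff_commute:
  fixes f :: "'a :: idom mpoly"
  assumes "\<And>j. j \<in> set ws \<Longrightarrow> Suc i < j \<or> Suc j < i"
  shows "fold ddiff ws (ddiff i f) = ddiff i (fold ddiff ws f)"
  using assms
proof (induction ws arbitrary: f)
  case (Cons a ws)
  have "ddiff a (ddiff i f) = ddiff i (ddiff a f)"
    by (rule ddiff_commute) (use Cons.prems in force)
  then show ?case using Cons by simp
qed simp

lemma fold_ddiff_commute_fold:
  fixes f :: "'a :: idom mpoly"
  assumes "\<And>i j. i \<in> set vs \<Longrightarrow> j \<in> set ws \<Longrightarrow> Suc i < j \<or> Suc j < i"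
  shows "fold ddiff ws (fold ddiff vs f) = fold ddiff vs (fold ddiff ws f)"
  using assms by (induction vs arbitrary: f) (simp_all add: fold_ddiff_commute)

lemma upt_split: "a \<le> b \<Longrightarrow> b \<le> c \<Longrightarrow> [a..<c] = [a..<b] @ [b..<c]"
  by (metis le_add_diff_inverse upt_add_eq_append)

text \<open>Only the letters j and j + 1 of the word interact with \<open>ddiff (Suc j)\<close>;
  there the braid relation applies, and all other letters commute with what has to pass. Thus a
  divided difference loses one index on its way through an increasing word.\<close>

lemma fold_ddiff_upt_shift:
  fixes f :: "'a :: idom mpoly"
  assumes "a \<le> j" "0 < j" "Suc j < n"
  shows "fold ddiff [a..<n] (ddiff (Suc j) f) = ddiff j (fold ddiff [a..<n] f)"
proof -
  have split: "[a..<n] = [a..<j] @ j # Suc j # [Suc (Suc j)..<n]"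
    using assms upt_split[of a j n] by (simp add: upt_conv_Cons)
  have "fold ddiff [a..<j] (ddiff (Suc j) f) = ddiff (Suc j) (fold ddiff [a..<j] f)"
    by (rule fold_ddiff_commute) auto
  moreover have "fold ddiff [Suc (Suc j)..<n] (ddiff j g) = ddiff j (fold ddiff [Suc (Suc j)..<n] g)"
    for g :: "'a mpoly"
    by (rule fold_ddiff_commute) auto
  ultimately show ?thesis
    unfolding split using assms by (simp add: ddiff_braid[symmetric])
qed

lemma fold_ddiff_rev_upt_shift:
  fixes f :: "'a :: idom mpoly"
  assumes "0 < j" "Suc j < m"
  shows "ddiff (Suc j) (fold ddiff (rev [1..<m]) f) = fold ddiff (rev [1..<m]) (ddiff j f)"
proof -
  have split: "[1..<m] = [1..<j] @ j # Suc j # [Suc (Suc j)..<m]"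
    using assms upt_split[of 1 j m] by (simp add: upt_conv_Cons)
  have "fold ddiff (rev [Suc 0..<j]) (ddiff (Suc j) g) = ddiff (Suc j) (fold ddiff (rev [Suc 0..<j]) g)"
    for g :: "'a mpoly"
    by (rule fold_ddiff_commute) auto
  moreover have "fold ddiff (rev [Suc (Suc j)..<m]) (ddiff j f) = ddiff j (fold ddiff (rev [Suc (Suc j)..<m]) f)"
    by (rule fold_ddiff_commute) auto
  ultimately show ?thesis
    unfolding split using assms by (simp add: ddiff_braid flip: One_nat_def)
qed

text \<open>The operator $\nabla_1^B(n)$.\<close>

definition sig :: "nat \<Rightarrow> 'a mpoly \<Rightarrow> 'a :: idom mpoly" where
  "sig n = fold ddiff [0..<n]"

lemma sig_0 [simp]: "sig n 0 = 0"
  by (simp add: sig_def)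

lemma sig_Suc: "sig (Suc n) f = ddiff n (sig n f)"
  by (simp add: sig_def)

lemma sig_split: "m \<le> n \<Longrightarrow> sig n f = fold ddiff [m..<n] (sig m f)"
  unfolding sig_def by (subst upt_split[of 0 m n]) simp_all

lemma sig_ddiff: "0 < j \<Longrightarrow> Suc j < n \<Longrightarrow> sig n (ddiff (Suc j) f) = ddiff j (sig n f)"
  unfolding sig_def by (rule fold_ddiff_upt_shift) auto

lemma fold_ddiff_upt_twice:
  fixes f :: "'a :: idom mpoly"
  assumes "m < n"
  shows "fold ddiff [1..<n] (fold ddiff [2..<Suc m] f) = fold ddiff [1..<m] (fold ddiff [1..<n] f)"
  using assms by (induction m) (auto simp: fold_ddiff_upt_shift numeral_2_eq_2)

text \<open>The index 1 cannot be lowered by one passage, since 0 and 1 satisfy only the four-letter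
  relation. That relation involves the initial letters of two successive words: the index 1 followed
  by 0, 1, 0 becomes 0, 1, 0, 1, and the last 1 completes 2, ..., n + 1 to a word which, passed
  through the next one, leaves the largest index at the end.\<close>

lemma sig_sig_ddiff_1:
  fixes f :: "'a :: idom mpoly"
  shows "sig (Suc n) (sig (Suc (Suc n)) (ddiff 1 f)) = ddiff (Suc n) (sig (Suc n) (sig (Suc (Suc n)) f))"
proof -
  let ?F = "fold ddiff :: nat list \<Rightarrow> 'a mpoly \<Rightarrow> 'a mpoly"
  have c: "?F [2..<Suc (Suc n)] (ddiff 0 g) = ddiff 0 (?F [2..<Suc (Suc n)] g)" for g
    by (rule fold_ddiff_commute) auto
  have split: "[0..<Suc (Suc n)] = 0 # 1 # [2..<Suc (Suc n)]" "[0..<Suc n] = 0 # [1..<Suc n]"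
    "[1..<Suc (Suc n)] = 1 # [2..<Suc (Suc n)]"
    by (simp_all add: upt_conv_Cons numeral_2_eq_2 del: upt_Suc)
  define g where "g = ddiff 0 (ddiff 1 (ddiff 0 f))"
  have "sig (Suc n) (sig (Suc (Suc n)) (ddiff 1 f)) =
      ?F [1..<Suc n] (?F [2..<Suc (Suc n)] (ddiff 0 (ddiff 1 (ddiff 0 (ddiff 1 f)))))"
    unfolding sig_def split by (simp add: c del: upt_Suc)
  also have "ddiff 0 (ddiff 1 (ddiff 0 (ddiff 1 f))) = ddiff 1 g"
    by (simp add: g_def ddiff_braid_0)
  also have "?F [1..<Suc n] (?F [2..<Suc (Suc n)] (ddiff 1 g)) = ?F [1..<Suc n] (?F [1..<Suc (Suc n)] g)"
    unfolding split by simp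
  also have "\<dots> = ?F [1..<Suc (Suc n)] (?F [2..<Suc (Suc n)] g)"
    by (rule fold_ddiff_upt_twice[symmetric]) simp
  also have "\<dots> = ddiff (Suc n) (?F [1..<Suc n] (?F [2..<Suc (Suc n)] g))"
    by simp
  also have "\<dots> = ddiff (Suc n) (sig (Suc n) (sig (Suc (Suc n)) f))"
    unfolding sig_def split g_def by (simp add: c del: upt_Suc)
  finally show ?thesis .
qed

lemma sig_power_0 [simp]: "(sig n ^^ j) 0 = 0"
  by (induction j) simp_all

text \<open>A divided difference with index i loses one index per application of
  \<open>sig n\<close> until it has index 1, which two further applications kill; index 0 is killed
  by one. In total i + 1 applications suffice.\<close>

lemma sig_power_ddiff:
  assumes "i < j" "j \<le> n"
  shows "(sig n ^^ j) (ddiff i f) = 0"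
  using assms
proof (induction j arbitrary: i f)
  case (Suc j)
  consider "i = 0" | "i = 1" | i' where "i = Suc i'" "0 < i'"
    by (metis One_nat_def gr0I not0_implies_Suc)
  then show ?case
  proof cases
    case 1
    then have "sig n (ddiff i f) = 0"
      using Suc.prems sig_split[of 1 n "ddiff i f"] by (simp add: sig_def)
    then show ?thesis by (simp add: funpow_swap1)
  next
    case 2
    obtain m l where ml: "n = Suc (Suc m)" "j = Suc l"
      using 2 Suc.prems by (metis One_nat_def Suc_le_D Suc_less_eq less_Suc_eq_le not0_implies_Suc not_less_zero)
    \<comment> \<open>By \<open>sig_sig_ddiff_1\<close> the inner part already ends with the letter
      n - 1, which is also the last letter of the outer \<open>sig n\<close>.\<close>
    have "sig n (sig n (ddiff i f)) = 0"
      using sig_sig_ddiff_1[of m f] unfolding ml 2 by (simp add: sig_Suc[of "Suc m" "sig (Suc (Suc m)) _"])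
    then show ?thesis by (simp add: ml funpow_swap1)
  next
    case 3
    then have "sig n (ddiff i f) = ddiff i' (sig n f)"
      using Suc.prems by (simp add: sig_ddiff)
    then show ?thesis using Suc 3 by (simp add: funpow_swap1)
  qed
qed simp

section \<open>The factorization of the powers of \<sigma>\<close>

lemma nabla_B_0 [simp]: "nabla_B 0 n f = f"
  by (simp add: nabla_B_def)

lemma nabla_B_Suc: "nabla_B (Suc k) n f = sig (n - k) (nabla_B k n f)"
  by (simp add: nabla_B_def sig_def)

lemma nabla_B_Suc_left: "nabla_B (Suc k) n f = nabla_B k (n - 1) (sig n f)"
  by (induction k arbitrary: f) (simp_all add: nabla_B_Suc)

lemma fold_ddiff_nabla_B:
  assumes "\<And>j. j \<in> set ws \<Longrightarrow> n \<le> j"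
  shows "nabla_B k (n - 1) (fold ddiff ws f) = fold ddiff ws (nabla_B k (n - 1) (f :: 'a :: idom mpoly))"
  unfolding nabla_B_def by (rule fold_ddiff_commute_fold) (use assms in \<open>fastforce\<close>)

text \<open>The first j - 1 factors lower the index to 1. The next two turn it into n - j, the top
  index at that stage, and this commutes with all letters of the remaining factors.\<close>

lemma nabla_B_ddiff:
  fixes f :: "'a :: idom mpoly"
  assumes "1 \<le> j" "j < k" "k \<le> n"
  shows "nabla_B k n (ddiff j f) = ddiff (n - j) (nabla_B k n f)"
  using assms
proof (induction k arbitrary: n j f)
  case (Suc k)
  show ?case
  proof (cases "j = 1")
    case True
    then obtain m l where ml: "n = Suc (Suc m)" "k = Suc l"
      using Suc.prems by (metis One_nat_def Suc_le_D Suc_less_eq less_Suc_eq_le not0_implies_Suc not_less_zero)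
    show ?thesis
      using fold_ddiff_nabla_B[of "[Suc m]" "Suc m" l]
      by (simp add: ml True nabla_B_Suc_left sig_sig_ddiff_1[simplified])
  next
    case False
    then obtain i where i: "j = Suc i" "0 < i" using Suc.prems by (cases j) auto
    have "nabla_B (Suc k) n (ddiff j f) = nabla_B k (n - 1) (ddiff i (sig n f))"
      using Suc.prems i by (simp add: nabla_B_Suc_left sig_ddiff)
    also have "\<dots> = ddiff (n - 1 - i) (nabla_B k (n - 1) (sig n f))"
      using Suc.prems i by (intro Suc.IH) auto
    finally show ?thesis by (simp add: nabla_B_Suc_left i)
  qed
qed simp

lemma nabla_B_fold_ddiff:
  fixes f :: "'a :: idom mpoly"
  assumes "set ws \<subseteq> {1..<k}" "k \<le> n"
  shows "nabla_B k n (fold ddiff ws f) = fold ddiff (map (\<lambda>j. n - j) ws) (nabla_B k n f)"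
  using assms by (induction ws arbitrary: f) (simp_all add: nabla_B_ddiff)

text \<open>A reduced word of the longest permutation of $x_1,\ldots,x_k$.\<close>

primrec sym_word :: "nat \<Rightarrow> nat list" where
  "sym_word 0 = []"
| "sym_word (Suc k) = sym_word k @ rev [1..<Suc k]"

lemma set_sym_word: "set (sym_word k) \<subseteq> {1..<k}"
  by (induction k) auto

text \<open>In the induction step, \<sigma> is the next factor of the product followed by the
  letters n - k, ..., n - 1. By \<open>nabla_B_ddiff\<close> these move to the front as k, ..., 1,
  which is what \<open>sym_word\<close> appends.\<close>

lemma sig_power_eq_nabla_B:
  fixes f :: "'a :: idom mpoly"
  assumes "k \<le> n"
  shows "(sig n ^^ k) f = nabla_B k n (fold ddiff (sym_word k) f)"
  using assms
proof (induction k)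
  case (Suc k)
  let ?g = "fold ddiff (sym_word k) f"
  have map: "map (\<lambda>j. n - j) (rev [1..<Suc k]) = [n - k..<n]"
    using Suc.prems by (intro nth_equalityI) (auto simp: rev_nth simp del: upt_Suc)
  have "(sig n ^^ Suc k) f = fold ddiff [n - k..<n] (nabla_B (Suc k) n ?g)"
    using Suc sig_split[of "n - k" n] by (simp add: nabla_B_Suc)
  also have "\<dots> = nabla_B (Suc k) n (fold ddiff (rev [1..<Suc k]) ?g)"
    unfolding map[symmetric] using Suc.prems by (intro nabla_B_fold_ddiff[symmetric]) auto
  finally show ?case by (simp del: upt_Suc)
qed simp

text \<open>In other words, the image is symmetric in the first k variables. The word ends with 1,
  which settles i = 1; a larger index moves back through the last descending block and drops by
  one.\<close>

lemma ddiff_sym_word: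
  fixes f :: "'a :: idom mpoly"
  assumes "1 \<le> i" "i < k"
  shows "ddiff i (fold ddiff (sym_word k) f) = 0"
  using assms
proof (induction k arbitrary: i)
  case (Suc k)
  show ?case
  proof (cases "i = 1")
    case True
    have "[1..<Suc k] = 1 # [2..<Suc k]"
      using True Suc.prems by (simp add: upt_conv_Cons numeral_2_eq_2 del: upt_Suc)
    then show ?thesis by (simp add: True del: upt_Suc)
  next
    case False
    then obtain j where j: "i = Suc j" "0 < j" using Suc.prems by (cases i) auto
    then have "ddiff i (fold ddiff (rev [1..<Suc k]) (fold ddiff (sym_word k) f)) =
        fold ddiff (rev [1..<Suc k]) (ddiff j (fold ddiff (sym_word k) f))"
      using Suc.prems by (simp only: fold_ddiff_rev_upt_shift)
    then show ?thesis using Suc j by (simp del: upt_Suc)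
  qed
qed simp

section \<open>Iterating the operator on monomials\<close>

lemma ddiff_X_power:
  assumes "0 < i"
  shows "ddiff i (X i ^ d) = (\<Sum>p<d. X i ^ p * X (Suc i) ^ (d - Suc p) :: 'a :: idom mpoly)"
proof (rule ddiff_eqI)
  show "(\<Sum>p<d. X i ^ p * X (Suc i) ^ (d - Suc p)) * ddiff_denom i = X i ^ d - reflect i (X i ^ d :: 'a mpoly)"
    using assms power_diff_sumr2[of "X i" d "X (Suc i) :: 'a mpoly"]
    by (simp add: ddiff_denom_def reflect_X mult.commute)
qed

lemma ddiff_X_Suc_power:
  assumes "0 < i"
  shows "ddiff i (X (Suc i) ^ d) = - (\<Sum>p<d. X (Suc i) ^ p * X i ^ (d - Suc p) :: 'a :: idom mpoly)"
proof (rule ddiff_eqI)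
  have "(\<Sum>p<d. X (Suc i) ^ p * X i ^ (d - Suc p)) * - ddiff_denom i = X (Suc i) ^ d - reflect i (X (Suc i) ^ d :: 'a mpoly)"
    using assms power_diff_sumr2[of "X (Suc i)" d "X i :: 'a mpoly"]
    by (simp add: ddiff_denom_def reflect_X mult.commute)
  then show "- (\<Sum>p<d. X (Suc i) ^ p * X i ^ (d - Suc p)) * ddiff_denom i = X (Suc i) ^ d - reflect i (X (Suc i) ^ d :: 'a mpoly)"
    by simp
qed

text \<open>Every letter lowers the degree by one, so powers below the length of the word vanish and
  the boundary case is constant. Of the summands of \<open>ddiff_X_power\<close>, only the one with
  no factor \<open>X a\<close> survives.\<close>

lemma fold_ddiff_upt_X_power:
  assumes "0 < a" "d \<le> l"
  shows "fold ddiff [a..<a + l] (X a ^ d :: 'a :: idom mpoly) = (if d = l then 1 else 0)"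
  using assms
proof (induction l arbitrary: a d)
  case (Suc l)
  have "[a..<a + Suc l] = a # [Suc a..<Suc a + l]"
    by (simp add: upt_conv_Cons del: upt_Suc)
  then have "fold ddiff [a..<a + Suc l] (X a ^ d :: 'a mpoly) =
      (\<Sum>p<d. fold ddiff [Suc a..<Suc a + l] (X a ^ p * X (Suc a) ^ (d - Suc p)))"
    using Suc.prems by (simp add: ddiff_X_power fold_ddiff_sum del: upt_Suc)
  also have "\<dots> = (\<Sum>p<d. X a ^ p * fold ddiff [Suc a..<Suc a + l] (X (Suc a) ^ (d - Suc p)))"
    by (intro sum.cong refl fold_ddiff_mult_invariant) (auto simp: reflect_X)
  also have "\<dots> = (\<Sum>p<d. X a ^ p * (if d - Suc p = l then 1 else 0))"
    using Suc.prems by (intro sum.cong refl arg_cong2[where f = "(*)"] Suc.IH) auto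
  also have "\<dots> = (\<Sum>p<d. if p = 0 \<and> d = Suc l then 1 else 0)"
    using Suc.prems by (intro sum.cong) auto
  also have "\<dots> = (if d = Suc l then 1 else 0)"
    by (auto simp: sum.delta)
  finally show ?case .
qed simp

lemma fold_ddiff_rev_upt_X_power:
  assumes "0 < a" "d \<le> l"
  shows "fold ddiff (rev [a..<a + l]) (X (a + l) ^ d :: 'a :: idom mpoly) = (if d = l then (- 1) ^ l else 0)"
  using assms
proof (induction l arbitrary: d)
  case (Suc l)
  let ?b = "a + l"
  have "fold ddiff (rev [a..<a + Suc l]) (X (a + Suc l) ^ d :: 'a mpoly) =
      - (\<Sum>p<d. fold ddiff (rev [a..<?b]) (X (Suc ?b) ^ p * X ?b ^ (d - Suc p)))"
    using Suc.prems by (simp add: ddiff_X_Suc_power fold_ddiff_sum fold_ddiff_minus)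
  also have "(\<Sum>p<d. fold ddiff (rev [a..<?b]) (X (Suc ?b) ^ p * X ?b ^ (d - Suc p)) :: 'a mpoly) =
      (\<Sum>p<d. X (Suc ?b) ^ p * fold ddiff (rev [a..<?b]) (X ?b ^ (d - Suc p)))"
    by (intro sum.cong refl fold_ddiff_mult_invariant) (auto simp: reflect_X)
  also have "\<dots> = (\<Sum>p<d. X (Suc ?b) ^ p * (if d - Suc p = l then (- 1) ^ l else 0))"
    using Suc.prems by (intro sum.cong refl arg_cong2[where f = "(*)"] Suc.IH) auto
  also have "\<dots> = (\<Sum>p<d. if p = 0 \<and> d = Suc l then (- 1) ^ l else 0)"
    using Suc.prems by (intro sum.cong) auto
  also have "\<dots> = (if d = Suc l then (- 1) ^ l else 0)"
    by (auto simp: sum.delta)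
  finally show ?case by simp
qed simp

text \<open>Integration by parts. Up to the image of \<open>ddiff i\<close>, which \<open>V\<close>
  annihilates, \<open>ddiff i h * g\<close> equals \<open>h * ddiff i g\<close>: the signs work out
  because \<open>ddiff i\<close> negates under \<open>reflect i\<close>. It is applied with
  \<open>V\<close> built from a power of \<open>sig n\<close> and with \<open>V\<close> the
  antisymmetrizer.\<close>

lemma fold_ddiff_adjoint:
  fixes V :: "'a :: idom mpoly \<Rightarrow> 'a mpoly"
  assumes add: "\<And>f g. V (f + g) = V f + V g" and "\<And>i f. i \<in> set ws \<Longrightarrow> V (ddiff i f) = 0"
  shows "V (fold ddiff ws f * g) = V (f * fold ddiff (rev ws) g)"
  using assms(2)
proof (induction ws arbitrary: g rule: rev_induct)
  case (snoc i ws)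
  let ?h = "fold ddiff ws f"
  have "ddiff i ?h * g = ddiff i (?h * reflect i g) + ?h * ddiff i g"
    by (simp add: ddiff_mult ddiff_reflect)
  then show ?case using snoc by (simp add: add)
qed simp

lemma sig_add: "sig n (f + g) = sig n f + sig n g"
  and sig_diff: "sig n (f - g) = sig n f - sig n g"
  by (simp_all add: sig_def fold_ddiff_add fold_ddiff_diff)

lemma sig_power_add: "(sig n ^^ j) (f + g) = (sig n ^^ j) f + (sig n ^^ j) g"
  by (induction j) (simp_all add: sig_add)

lemma sig_power_diff: "(sig n ^^ j) (f - g) = (sig n ^^ j) f - (sig n ^^ j) g"
  by (induction j) (simp_all add: sig_diff)

lemma sig_power_sum: "(sig n ^^ j) (sum h A) = (\<Sum>x\<in>A. (sig n ^^ j) (h x))"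
  by (induction A rule: infinite_finite_induct) (simp_all add: sig_power_add)

text \<open>The power of \<open>x_(j+1)\<close> meets its first obstacle at the letter j. There the
  Leibniz rule yields the power of \<open>x_j\<close> in front of \<open>sig n H\<close>, and
  correction terms which the remaining j applications of \<open>sig n\<close> must kill.\<close>

lemma sig_power_Suc_X_power:
  fixes H :: "'a :: idom mpoly"
  assumes j: "1 \<le> j" "j < n" and H: "\<And>i. Suc j \<le> i \<Longrightarrow> i < n \<Longrightarrow> reflect i H = H" and b: "b < n"
  shows "(sig n ^^ Suc j) (X (Suc j) ^ b * H) = (sig n ^^ j) (X j ^ b * sig n H)"
proof -
  define P where "P = fold ddiff [0..<j] H"
  define q where "q c = fold ddiff [Suc j..<n] (X (Suc j) ^ c :: 'a mpoly)" for c
  have P_inv: "reflect i P = P" if "i \<in> set [Suc j..<n]" for i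
  proof -
    have "ddiff i P = fold ddiff [0..<j] (ddiff i H)"
      unfolding P_def using that by (intro fold_ddiff_commute[symmetric]) auto
    also have "ddiff i H = 0" using H that by (simp add: ddiff_eq_0_iff)
    finally show ?thesis by (simp add: ddiff_eq_0_iff)
  qed
  have P_eq: "fold ddiff [0..<j] (X (Suc j) ^ b * H) = X (Suc j) ^ b * P"
    unfolding P_def by (intro fold_ddiff_mult_invariant) (auto simp: reflect_X)
  have sig: "sig n f = fold ddiff [Suc j..<n] (ddiff j (fold ddiff [0..<j] f))" for f :: "'a mpoly"
    using sig_split[of "Suc j" n f] j by (simp add: sig_def)
  have "ddiff j (X (Suc j) ^ b * P) = X j ^ b * ddiff j P - (\<Sum>c<b. (P * X j ^ (b - Suc c)) * X (Suc j) ^ c)"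
    using j ddiff_mult[of j P "X (Suc j) ^ b"]
    by (simp add: ddiff_X_Suc_power reflect_X sum_distrib_left mult_ac)
  also have "fold ddiff [Suc j..<n] \<dots> = X j ^ b * fold ddiff [Suc j..<n] (ddiff j P) -
      (\<Sum>c<b. (P * X j ^ (b - Suc c)) * q c)"
    unfolding fold_ddiff_diff fold_ddiff_sum q_def
    by (intro arg_cong2[where f = "(-)"] sum.cong refl fold_ddiff_mult_invariant)
      (auto simp: reflect_X P_inv)
  finally have step: "sig n (X (Suc j) ^ b * H) = X j ^ b * sig n H - (\<Sum>c<b. (P * X j ^ (b - Suc c)) * q c)"
    unfolding sig P_eq by (simp add: P_def)
  \<comment> \<open>Either \<open>q c\<close> vanishes because c is smaller than the length n - 1 -
    j of its word, or b < n forces b - 1 - c to be at most j - 1. In the latter case the word hidden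
    in \<open>P\<close> is transposed onto the power of \<open>X j\<close>.\<close>
  have "(sig n ^^ j) ((P * X j ^ (b - Suc c)) * q c) = 0" if c: "c < b" for c
  proof (cases "c < n - Suc j")
    case True
    then show ?thesis
      using fold_ddiff_upt_X_power[of "Suc j" c "n - Suc j", where ?'a = 'a] j by (simp add: q_def)
  next
    case False
    have q_inv: "reflect i (q c) = q c" if "i < j" for i
    proof -
      have "ddiff i (q c) = fold ddiff [Suc j..<n] (ddiff i (X (Suc j) ^ c))"
        unfolding q_def using that by (intro fold_ddiff_commute[symmetric]) auto
      also have "ddiff i (X (Suc j) ^ c :: 'a mpoly) = 0"
        using that by (auto simp: ddiff_eq_0_iff reflect_X)
      finally show ?thesis by (simp add: ddiff_eq_0_iff)
    qed
    have kill: "(sig n ^^ j) (ddiff i f * q c) = 0" if "i < j" for i f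
      using j that by (simp add: sig_power_ddiff q_inv flip: ddiff_mult_invariant_right)
    obtain l where l: "j = Suc l" using j by (cases j) auto
    \<comment> \<open>The l = j - 1 descending letters reduce an exponent of at most l to a
      constant, and the final letter 0 of the transposed word kills constants.\<close>
    have "fold ddiff (rev [1..<1 + l]) (X (1 + l) ^ (b - Suc c) :: 'a mpoly) =
        (if b - Suc c = l then (- 1) ^ l else 0)"
      using b False c l by (intro fold_ddiff_rev_upt_X_power) auto
    moreover have "ddiff 0 ((- 1) ^ l :: 'a mpoly) = 0"
      by (simp add: ddiff_eq_0_iff)
    moreover have "rev [0..<j] = rev [1..<1 + l] @ [0]"
      by (simp add: l upt_conv_Cons del: upt_Suc)
    ultimately have "fold ddiff (rev [0..<j]) (X j ^ (b - Suc c) :: 'a mpoly) = 0"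
      by (simp add: l del: upt_Suc)
    then show ?thesis
      using fold_ddiff_adjoint[of "\<lambda>f. (sig n ^^ j) (f * q c)" "[0..<j]" H "X j ^ (b - Suc c)"]
      by (simp add: kill sig_power_add distrib_right P_def)
  qed
  then show ?thesis
    by (simp add: step sig_power_diff sig_power_sum funpow_swap1[of "sig n"])
qed

text \<open>Moving \<open>ddiff i\<close> back through \<open>sig n\<close> raises its index by one,
  so each application extends the symmetry of \<open>H\<close> to one more variable, namely
  \<open>x_a\<close>. The index n - 1 is the last letter of the word itself.\<close>

lemma sig_invariant:
  assumes "\<And>i. a < i \<Longrightarrow> i < n \<Longrightarrow> reflect i H = H" "0 < a" "a \<le> i" "i < n"
  shows "reflect i (sig n H) = sig n H"
proof -
  have "ddiff i (sig n H) = 0"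
  proof (cases "Suc i < n")
    case True
    then have "ddiff (Suc i) H = 0" using assms by (simp add: ddiff_eq_0_iff)
    then show ?thesis using True assms sig_ddiff[of i n H] by simp
  next
    case False
    then have "n = Suc i" using assms by simp
    then show ?thesis by (simp add: sig_Suc)
  qed
  then show ?thesis by (simp add: ddiff_eq_0_iff)
qed

lemma sig_power_invariant:
  assumes "\<And>i. a + r \<le> i \<Longrightarrow> i < n \<Longrightarrow> reflect i H = H" "0 < a" "a \<le> i" "i < n"
  shows "reflect i ((sig n ^^ r) H) = (sig n ^^ r) H"
  using assms
proof (induction r arbitrary: a i)
  case (Suc r)
  then have "reflect i ((sig n ^^ r) H) = (sig n ^^ r) H" if "a < i" "i < n" for i
    using that by (intro Suc.IH[of "Suc a"]) auto
  then show ?case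
    using Suc.prems sig_invariant[of a n "(sig n ^^ r) H" i] by simp
qed simp

lemma sig_power_move:
  fixes H :: "'a :: idom mpoly"
  assumes "r < k" "k \<le> n" "b < n" and H: "\<And>i. k \<le> i \<Longrightarrow> i < n \<Longrightarrow> reflect i H = H"
  shows "(sig n ^^ k) (X k ^ b * H) = (sig n ^^ (k - r)) (X (k - r) ^ b * (sig n ^^ r) H)"
  using assms(1)
proof (induction r)
  case (Suc r)
  define j where "j = k - Suc r"
  have j: "k - r = Suc j" "0 < j" "j < n" using Suc.prems assms by (auto simp: j_def)
  have "reflect i ((sig n ^^ r) H) = (sig n ^^ r) H" if "Suc j \<le> i" "i < n" for i
    using H that j Suc.prems by (intro sig_power_invariant[of "Suc j"]) auto
  then have "(sig n ^^ Suc j) (X (Suc j) ^ b * (sig n ^^ r) H) = (sig n ^^ j) (X j ^ b * sig n ((sig n ^^ r) H))"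
    using j assms by (intro sig_power_Suc_X_power) auto
  then show ?case using Suc j by (simp add: j_def)
qed simp

text \<open>The bound concerns only \<open>tl bs\<close>: the head belongs to \<open>x_1\<close>,
  which need not be moved. In the induction the last power passes through all applications but one
  and arrives at \<open>x_1\<close>.\<close>

lemma sig_power_monomial:
  fixes F :: "'a :: idom mpoly"
  assumes F: "\<And>i. 1 \<le> i \<Longrightarrow> i < n \<Longrightarrow> reflect i F = F"
    and "length bs \<le> n" "\<And>b. b \<in> set (tl bs) \<Longrightarrow> b < n"
  shows "(sig n ^^ length bs) (F * (\<Prod>j<length bs. X (Suc j) ^ (bs ! j))) =
    fold (\<lambda>b G. sig n (X 1 ^ b * G)) bs F"
  using assms(2,3)
proof (induction bs rule: rev_induct)
  case (snoc b bs)
  define k where "k = Suc (length bs)"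
  define H where "H = F * (\<Prod>j<length bs. X (Suc j) ^ (bs ! j))"
  have IH: "(sig n ^^ length bs) H = fold (\<lambda>b G. sig n (X 1 ^ b * G)) bs F"
    unfolding H_def
  proof (rule snoc.IH)
    show "c < n" if "c \<in> set (tl bs)" for c
      using that snoc.prems(2)[of c] by (cases bs) auto
  qed (use snoc.prems in simp)
  have "F * (\<Prod>j<length (bs @ [b]). X (Suc j) ^ ((bs @ [b]) ! j)) = X k ^ b * H"
    by (simp add: H_def k_def nth_append mult_ac)
  moreover have "(sig n ^^ k) (X k ^ b * H) = sig n (X 1 ^ b * (sig n ^^ length bs) H)"
  proof (cases "bs = []")
    case False
    have "reflect i H = H" if "k \<le> i" "i < n" for i
      unfolding H_def reflect_mult reflect_prod
      using that F[of i] by (intro arg_cong2[where f = "(*)"] prod.cong) (auto simp: reflect_X k_def)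
    moreover have "b < n" using snoc.prems(2)[of b] False by (cases bs) auto
    ultimately have "(sig n ^^ k) (X k ^ b * H) = (sig n ^^ (k - length bs)) (X (k - length bs) ^ b * (sig n ^^ length bs) H)"
      using snoc.prems by (intro sig_power_move) (auto simp: k_def)
    then show ?thesis by (simp add: k_def)
  qed (simp add: k_def)
  ultimately show ?case
    by (simp only: IH k_def length_append_singleton fold_append fold_Cons fold_Nil o_apply id_apply)
qed simp

section \<open>Schur polynomials as divided differences\<close>

text \<open>Permutations of \<open>{0..<k}\<close> act on the variables $x_1,\ldots,x_k$, hence the shift.\<close>

definition permute_vars :: "(nat \<Rightarrow> nat) \<Rightarrow> 'a mpoly \<Rightarrow> 'a :: comm_ring_1 mpoly" where
  "permute_vars p = poly_subst (\<lambda>v. X (case v of 0 \<Rightarrow> 0 | Suc u \<Rightarrow> Suc (p u)))"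

definition antisymmetrize :: "nat \<Rightarrow> 'a mpoly \<Rightarrow> 'a :: comm_ring_1 mpoly" where
  "antisymmetrize k f = (\<Sum>p | p permutes {0..<k}. of_int (sign p) * permute_vars p f)"

lemma antisymmetrize_add: "antisymmetrize k (f + g) = antisymmetrize k f + antisymmetrize k g"
  by (simp add: antisymmetrize_def permute_vars_def poly_subst_add distrib_left sum.distrib)

lemma reflect_conv_permute_vars: "reflect (Suc i) = permute_vars (transpose i (Suc i))"
  by (rule ext)
    (auto simp: reflect_def permute_vars_def transpose_def split: nat.splits
      intro!: arg_cong[where f = "\<lambda>\<sigma>. poly_subst \<sigma> _"])

lemma permute_vars_comp: "permute_vars p (permute_vars q f) = permute_vars (p \<circ> q) f"
  unfolding permute_vars_def poly_subst_poly_subst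
  by (auto split: nat.splits intro!: arg_cong[where f = "\<lambda>\<sigma>. poly_subst \<sigma> _"])

lemma permute_vars_id: "permute_vars id f = f"
proof -
  have "(\<lambda>v. X (case v of 0 \<Rightarrow> 0 | Suc u \<Rightarrow> Suc (id u)) :: 'a mpoly) = X"
    by (auto split: nat.splits)
  then show ?thesis by (simp add: permute_vars_def poly_subst_X)
qed

lemma antisymmetrize_reflect:
  assumes "Suc i < k"
  shows "antisymmetrize k (reflect (Suc i) f) = - antisymmetrize k f"
proof -
  let ?t = "transpose i (Suc i)"
  have t: "?t permutes {0..<k}" using assms by (intro permutes_swap_id) auto
  have "antisymmetrize k f = (\<Sum>p | p permutes {0..<k}. of_int (sign (p \<circ> ?t)) * permute_vars (p \<circ> ?t) f)"
    unfolding antisymmetrize_def by (rule sum_permutations_compose_right[OF t])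
  also have "\<dots> = (\<Sum>p | p permutes {0..<k}. - (of_int (sign p) * permute_vars p (reflect (Suc i) f)))"
  proof (rule sum.cong, simp)
    fix p assume "p \<in> {p. p permutes {0..<k}}"
    then have "permutation p" by (auto intro: permutes_imp_permutation)
    then have "sign (p \<circ> ?t) = - sign p"
      by (simp add: sign_compose permutation_swap_id sign_swap_id)
    then show "of_int (sign (p \<circ> ?t)) * permute_vars (p \<circ> ?t) f =
        - (of_int (sign p) * permute_vars p (reflect (Suc i) f))"
      by (simp add: reflect_conv_permute_vars permute_vars_comp)
  qed
  finally show ?thesis by (simp add: antisymmetrize_def sum_negf)
qed

text \<open>A divided difference is fixed by its reflection, whereas the antisymmetrizer changes
  sign under it. Characteristic zero turns 2 A = 0 into A = 0.\<close>

lemma antisymmetrize_ddiff: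
  fixes f :: "'a :: {idom, ring_char_0} mpoly"
  assumes "1 \<le> i" "i < k"
  shows "antisymmetrize k (ddiff i f) = 0"
proof -
  obtain j where i: "i = Suc j" using assms by (cases i) auto
  have "antisymmetrize k (ddiff i f) = - antisymmetrize k (ddiff i f)"
    using antisymmetrize_reflect[of j k "ddiff i f"] assms by (simp add: i)
  then have "2 * antisymmetrize k (ddiff i f) = 0" by simp
  then show ?thesis by simp
qed

lemma permute_vars_transpose_invariant:
  assumes inv: "\<And>i. Suc i < k \<Longrightarrow> reflect (Suc i) g = g" and "a < b" "b < k"
  shows "permute_vars (transpose a b) g = g"
  using assms(2,3)
proof (induction "b - a" arbitrary: b)
  case (Suc d)
  show ?case
  proof (cases "b = Suc a")
    case True
    then show ?thesis using inv[of a] Suc.prems by (simp add: reflect_conv_permute_vars)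
  next
    case False
    then obtain c where c: "b = Suc c" "a < c" using Suc.prems by (cases b) auto
    have "transpose a b = transpose c (Suc c) \<circ> transpose a c \<circ> transpose c (Suc c)"
      using c by (auto simp: transpose_def fun_eq_iff)
    then have "permute_vars (transpose a b) g =
        reflect (Suc c) (permute_vars (transpose a c) (reflect (Suc c) g))"
      by (simp add: reflect_conv_permute_vars permute_vars_comp comp_assoc)
    then show ?thesis using Suc c inv[of c] by simp
  qed
qed simp

lemma permute_vars_invariant:
  assumes "p permutes {0..<k}" and inv: "\<And>i. Suc i < k \<Longrightarrow> reflect (Suc i) g = g"
  shows "permute_vars p g = g"
  using assms(1) finite_atLeastLessThan
proof (induction p rule: permutes_induct)
  case (swap a b p)
  have "permute_vars (transpose a b) g = g"
    using permute_vars_transpose_invariant[of k g a b] permute_vars_transpose_invariant[of k g b a]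
      swap.hyps inv by (cases a b rule: linorder_cases) (auto simp: transpose_commute)
  then show ?case using swap.IH permute_vars_comp[of "transpose a b" p g] by metis
qed (rule permute_vars_id)

lemma antisymmetrize_mult_invariant:
  assumes "\<And>i. Suc i < k \<Longrightarrow> reflect (Suc i) g = g"
  shows "antisymmetrize k (g * f) = g * antisymmetrize k f"
proof -
  have "permute_vars p (g * f) = g * permute_vars p f" if "p permutes {0..<k}" for p
    using permute_vars_invariant[OF that, of g] assms by (simp add: permute_vars_def poly_subst_mult)
  then show ?thesis by (simp add: antisymmetrize_def sum_distrib_left mult_ac)
qed

definition monomial :: "nat \<Rightarrow> (nat \<Rightarrow> nat) \<Rightarrow> 'a :: comm_ring_1 mpoly" where
  "monomial k a = (\<Prod>j<k. X (Suc j) ^ a j)"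

lemma permute_vars_monomial: "permute_vars p (monomial k a) = (\<Prod>j<k. X (Suc (p j)) ^ a j)"
  by (simp add: permute_vars_def monomial_def poly_subst_prod poly_subst_power)

lemma antisymmetrize_monomial: "antisymmetrize k (monomial k a) = (alternant k a :: 'a :: comm_ring_1 mpoly)"
proof -
  let ?A = "mat k k (\<lambda>(i, j). X (i + 1) ^ a j :: 'a mpoly)"
  have "alternant k a = (\<Sum>p | p permutes {0..<k}. signof p * (\<Prod>j<k. ?A $$ (p j, j)))"
    unfolding alternant_def by (rule det_col) simp
  also have "\<dots> = antisymmetrize k (monomial k a)"
    unfolding antisymmetrize_def permute_vars_monomial
    by (intro sum.cong arg_cong2[where f = "(*)"] prod.cong refl)
      (auto dest: permutes_in_image[where x = "_ :: nat"])
  finally show ?thesis by simp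
qed

text \<open>The exponents k - 1, ..., 0 are distinct, so the monomial of the identity permutation
  arises from no other permutation and has coefficient 1.\<close>

lemma vandermonde_nonzero: "alternant k (\<lambda>j. k - 1 - j) \<noteq> (0 :: 'a :: comm_ring_1 mpoly)"
proof
  let ?d = "\<lambda>j. k - 1 - j"
  define m where "m p = (\<Sum>j<k. Poly_Mapping.single (Suc (p j)) (?d j))" for p :: "nat \<Rightarrow> nat"
  have mono: "permute_vars p (monomial k ?d) = (Poly_Mapping.single (m p) 1 :: 'a mpoly)" for p
  proof -
    have "finite A \<Longrightarrow> (\<Prod>j\<in>A. X (Suc (p j)) ^ ?d j) =
        (Poly_Mapping.single (\<Sum>j\<in>A. Poly_Mapping.single (Suc (p j)) (?d j)) 1 :: 'a mpoly)" for A
      by (induction A rule: finite_induct) (simp_all add: X_power mult_single)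
    then show ?thesis by (simp add: permute_vars_monomial m_def)
  qed
  have m_lookup: "Poly_Mapping.lookup (m p) (Suc (p i)) = ?d i" if "p permutes {0..<k}" "i < k" for p i
  proof -
    have "inj p" using that permutes_inj by blast
    then show ?thesis
      using that by (simp add: m_def lookup_sum lookup_single when_def inj_eq)
  qed
  have m_id: "p = id" if p: "p permutes {0..<k}" and eq: "m p = m id" for p
  proof
    fix i show "p i = id i"
    proof (cases "i < k")
      case True
      then have "p i < k" using permutes_in_image[OF p, of i] by simp
      then have "?d i = ?d (p i)"
        using m_lookup[OF p True] m_lookup[OF permutes_id, of "p i"] eq by simp
      then show ?thesis using True \<open>p i < k\<close> by simp
    qed (use p in \<open>auto simp: permutes_def\<close>)
  qed
  assume "alternant k ?d = (0 :: 'a mpoly)"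
  then have "0 = Poly_Mapping.lookup (antisymmetrize k (monomial k ?d) :: 'a mpoly) (m id)"
    by (simp add: antisymmetrize_monomial)
  also have "\<dots> = (\<Sum>p | p permutes {0..<k}. Poly_Mapping.lookup (of_int (sign p) * Poly_Mapping.single (m p) 1 :: 'a mpoly) (m id))"
    by (simp only: antisymmetrize_def mono lookup_sum)
  also have "\<dots> = (\<Sum>p | p permutes {0..<k}. if p = id then 1 else 0)"
  proof (rule sum.cong, simp)
    fix p assume p: "p \<in> {p. p permutes {0..<k}}"
    have "of_int (sign p) * Poly_Mapping.single (m p) 1 = (Poly_Mapping.single (m p) (of_int (sign p)) :: 'a mpoly)"
      by (simp add: mult_single flip: single_of_int)
    then show "Poly_Mapping.lookup (of_int (sign p) * Poly_Mapping.single (m p) 1 :: 'a mpoly) (m id) = (if p = id then 1 else 0)"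
      using m_id[of p] p by (auto simp: lookup_single when_def)
  qed
  also have "\<dots> = 1" by (simp add: finite_permutations permutes_id)
  finally show False by simp
qed

text \<open>The reversed word for k + 1 begins with 1, ..., k. These letters lower the positive
  exponents of the staircase one after the other, which leaves the staircase for k.\<close>

lemma fold_ddiff_staircase:
  "fold ddiff (rev (sym_word k)) (monomial k (\<lambda>j. k - 1 - j)) = (1 :: 'a :: idom mpoly)"
proof (induction k)
  case (Suc k)
  have "fold ddiff [1..<Suc m] (monomial (Suc k) (\<lambda>j. k - j)) =
      ((\<Prod>j<m. X (Suc j) ^ (k - 1 - j)) * (\<Prod>j = m..k. X (Suc j) ^ (k - j)) :: 'a mpoly)"
    if "m \<le> k" for m
    using that
  proof (induction m)
    case 0
    show ?case by (simp add: monomial_def atLeast0AtMost lessThan_Suc_atMost)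
  next
    case (Suc m)
    \<comment> \<open>At this point \<open>x_(m+1)\<close> has exponent one larger than
      \<open>x_(m+2)\<close>. Splitting off a single \<open>X (Suc m)\<close> leaves the factor
      \<open>c\<close> fixed by the reflection, and the divided difference of
      \<open>X (Suc m)\<close> is 1.\<close>
    define c :: "'a mpoly" where "c = (\<Prod>j<m. X (Suc j) ^ (k - 1 - j)) *
        (X (Suc m) ^ (k - 1 - m) * X (Suc (Suc m)) ^ (k - 1 - m)) * (\<Prod>j = Suc (Suc m)..k. X (Suc j) ^ (k - j))"
    have c_inv: "reflect (Suc m) c = c"
      unfolding c_def reflect_mult reflect_prod
      by (intro arg_cong2[where f = "(*)"] prod.cong trans[OF _ mult.commute]) (auto simp: reflect_X)
    have "k - m = Suc (k - 1 - m)" using Suc.prems by simp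
    then have pow: "X (Suc m) ^ (k - m) = (X (Suc m) * X (Suc m) ^ (k - 1 - m) :: 'a mpoly)" by simp
    have "(\<Prod>j<m. X (Suc j) ^ (k - 1 - j)) * (\<Prod>j = m..k. X (Suc j) ^ (k - j)) = c * X (Suc m)"
      using Suc.prems by (simp add: prod.atLeast_Suc_atMost[of m k] prod.atLeast_Suc_atMost[of "Suc m" k] pow c_def mult_ac)
    then have "fold ddiff [1..<Suc (Suc m)] (monomial (Suc k) (\<lambda>j. k - j)) = ddiff (Suc m) (c * X (Suc m))"
      using Suc by simp
    also have "\<dots> = c"
      using c_inv ddiff_X_power[of "Suc m" 1, where ?'a = 'a] by (simp add: ddiff_mult_invariant_left)
    also have "\<dots> = (\<Prod>j<Suc m. X (Suc j) ^ (k - 1 - j)) * (\<Prod>j = Suc m..k. X (Suc j) ^ (k - j))"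
      using Suc.prems by (simp add: prod.atLeast_Suc_atMost[of "Suc m" k] c_def mult_ac)
    finally show ?case .
  qed
  from this[of k] have "fold ddiff [1..<Suc k] (monomial (Suc k) (\<lambda>j. k - j)) =
      (monomial k (\<lambda>j. k - 1 - j) :: 'a mpoly)"
    by (simp add: monomial_def)
  then show ?case using Suc by (simp del: upt_Suc)
qed (simp add: monomial_def)

text \<open>As \<open>?g\<close> is symmetric, its product with the Vandermonde determinant is the
  antisymmetrization of \<open>?g\<close> times the staircase monomial. Integration by parts moves
  the word onto that monomial, which becomes 1, so the alternant of the numerator is left.\<close>

lemma schur_eq_fold_ddiff:
  fixes mu :: "nat list"
  shows "schur k mu = fold ddiff (sym_word k) (monomial k (\<lambda>j. mu ! j + (k - 1 - j)) :: 'a :: {idom, ring_char_0} mpoly)"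
    (is "_ = ?g")
proof -
  let ?f = "monomial k (\<lambda>j. mu ! j + (k - 1 - j)) :: 'a mpoly"
  have sub: "i \<in> set (sym_word k) \<Longrightarrow> 1 \<le> i \<and> i < k" for i
    using set_sym_word[of k] by auto
  have "?g * alternant k (\<lambda>j. k - 1 - j) = antisymmetrize k (?g * monomial k (\<lambda>j. k - 1 - j))"
    by (subst antisymmetrize_mult_invariant) (simp_all add: antisymmetrize_monomial ddiff_sym_word flip: ddiff_eq_0_iff)
  also have "\<dots> = antisymmetrize k (?f * fold ddiff (rev (sym_word k)) (monomial k (\<lambda>j. k - 1 - j)))"
    by (rule fold_ddiff_adjoint) (simp add: antisymmetrize_add, rule antisymmetrize_ddiff, use sub in auto)
  also have "\<dots> = alternant k (\<lambda>j. mu ! j + (k - 1 - j))"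
    by (simp only: fold_ddiff_staircase mult_1_right antisymmetrize_monomial)
  finally have eq: "?g * alternant k (\<lambda>j. k - 1 - j) = alternant k (\<lambda>j. mu ! j + (k - 1 - j))" .
  show ?thesis
    unfolding schur_def
  proof (rule the_equality)
    show "s = ?g" if "s * alternant k (\<lambda>j. k - 1 - j) = alternant k (\<lambda>j. mu ! j + (k - 1 - j))" for s
      using that eq vandermonde_nonzero[of k, where ?'a = 'a] by (metis mult_right_cancel)
  qed (rule eq)
qed

section \<open>Signed removal of list entries\<close>

text \<open>The contraction of the form \<open>Q\<close> by the covector \<open>u\<close>, with the
  sign of the position: the shape of a row expansion of a Pfaffian.\<close>

fun alt_del :: "('b \<Rightarrow> 'a) \<Rightarrow> ('b list \<Rightarrow> 'a) \<Rightarrow> 'b list \<Rightarrow> 'a :: comm_ring_1" where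
  "alt_del u Q [] = 0"
| "alt_del u Q (x # xs) = u x * Q xs - alt_del u (\<lambda>ys. Q (x # ys)) xs"

lemma alt_del_cong:
  assumes "\<And>x. x \<in> set xs \<Longrightarrow> u x = v x" "\<And>ys. length xs = Suc (length ys) \<Longrightarrow> Q ys = R ys"
  shows "alt_del u Q xs = alt_del v R xs"
  using assms
proof (induction xs arbitrary: Q R)
  case (Cons x xs)
  have "alt_del u (\<lambda>ys. Q (x # ys)) xs = alt_del v (\<lambda>ys. R (x # ys)) xs"
    by (rule Cons.IH) (use Cons.prems in auto)
  then show ?case using Cons.prems by simp
qed simp

lemma alt_del_add: "alt_del u (\<lambda>ys. Q ys + R ys) xs = alt_del u Q xs + alt_del u R xs"
  by (induction xs arbitrary: Q R) (simp_all add: algebra_simps)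

lemma alt_del_diff: "alt_del u (\<lambda>ys. Q ys - R ys) xs = alt_del u Q xs - alt_del u R xs"
  by (induction xs arbitrary: Q R) (simp_all add: algebra_simps)

lemma alt_del_cmult: "alt_del u (\<lambda>ys. c * Q ys) xs = c * alt_del u Q xs"
  by (induction xs arbitrary: Q) (simp_all add: algebra_simps)

lemma alt_del_0 [simp]: "alt_del u (\<lambda>ys. 0) xs = 0"
  by (induction xs) simp_all

lemma alt_del_add_left: "alt_del (\<lambda>x. u x + v x) Q xs = alt_del u Q xs + alt_del v Q xs"
  by (induction xs arbitrary: Q) (simp_all add: algebra_simps)

lemma alt_del_diff_left: "alt_del (\<lambda>x. u x - v x) Q xs = alt_del u Q xs - alt_del v Q xs"
  by (induction xs arbitrary: Q) (simp_all add: algebra_simps)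

lemma alt_del_cmult_left: "alt_del (\<lambda>x. c * u x) Q xs = c * alt_del u Q xs"
  by (induction xs arbitrary: Q) (simp_all add: algebra_simps)

lemma alt_del_anticommute: "alt_del u (alt_del v Q) xs = - alt_del v (alt_del u Q) xs"
proof (induction xs arbitrary: Q)
  case (Cons x xs)
  have "alt_del u (\<lambda>ys. alt_del v Q (x # ys)) xs =
      v x * alt_del u Q xs - alt_del u (alt_del v (\<lambda>ys. Q (x # ys))) xs" for u v
    by (simp add: alt_del_diff alt_del_cmult)
  then show ?case using Cons[of "\<lambda>ys. Q (x # ys)"] by simp
qed simp

text \<open>Anticommutation alone gives only twice this value, and the coefficient ring may have
  characteristic two.\<close>

lemma alt_del_square: "alt_del u (alt_del u Q) xs = 0"
  by (induction xs arbitrary: Q) (simp_all add: alt_del_diff alt_del_cmult)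

lemma alt_del_snoc:
  "alt_del u Q (xs @ [y]) = alt_del u (\<lambda>ys. Q (ys @ [y])) xs + (- 1) ^ length xs * u y * Q xs"
  by (induction xs arbitrary: Q) (simp_all add: algebra_simps)

lemma alt_del_append:
  "alt_del u Q (xs @ ys) = alt_del u (\<lambda>zs. Q (zs @ ys)) xs + (- 1) ^ length xs * alt_del u (\<lambda>zs. Q (xs @ zs)) ys"
  by (induction xs arbitrary: Q) (simp_all add: algebra_simps)

lemma alt_del_zero:
  assumes "\<And>x. x \<in> set xs \<Longrightarrow> u x = 0"
  shows "alt_del u Q xs = 0"
  using assms by (induction xs arbitrary: Q) auto

lemma alt_del_eq_sum:
  "alt_del u Q xs = (\<Sum>j<length xs. (- 1) ^ j * u (xs ! j) * Q (take j xs @ drop (Suc j) xs))"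
  by (induction xs arbitrary: Q) (simp_all add: sum.lessThan_Suc_shift sum_negf del: sum.lessThan_Suc)

lemma alt_del_hom:
  assumes "h 0 = 0" "\<And>x y. h (x - y) = h x - h y" "\<And>x y. h (x * y) = h x * h y"
  shows "h (alt_del u Q xs) = alt_del (\<lambda>x. h (u x)) (\<lambda>ys. h (Q ys)) xs"
  using assms by (induction xs arbitrary: Q) simp_all

text \<open>The recursion of a Pfaffian along its first row, where an index list of odd length is extended
  by an additional index with entries \<open>e\<close>. Changing the matrix by
  the rank two matrix $e' e^T - e e'^T$ changes the Pfaffian linearly.\<close>

locale pfaffian_recursion =
  fixes M :: "'b \<Rightarrow> 'b \<Rightarrow> 'a :: comm_ring_1" and e :: "'b \<Rightarrow> 'a" and Q :: "'b list \<Rightarrow> 'a"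
  assumes Q_Nil: "Q [] = 1"
    and Q_Cons: "Q (x # xs) = alt_del (M x) Q xs + (if even (length xs) then e x * Q xs else 0)"
begin

text \<open>For odd length this is the expansion along the column of the additional index; for even
  length that index would occur twice. Both are derived from the first row recursion by letting the
  contractions by \<open>M x\<close> and \<open>e\<close> anticommute.\<close>

lemma alt_del_border: "alt_del e Q xs = (if odd (length xs) then Q xs else 0)"
proof (induction "length xs" arbitrary: xs rule: less_induct)
  case less
  show ?case
  proof (cases xs)
    case (Cons x ys)
    have c: "alt_del e (\<lambda>zs. Q (x # zs)) ys =
        alt_del e (\<lambda>zs. alt_del (M x) Q zs + (if odd (length ys) then e x * Q zs else 0)) ys"
      by (rule alt_del_cong) (auto simp: Q_Cons)
    have "alt_del e (alt_del (M x) Q) ys = - alt_del (M x) (alt_del e Q) ys"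
      by (rule alt_del_anticommute)
    also have "alt_del (M x) (alt_del e Q) ys = alt_del (M x) (\<lambda>zs. if even (length ys) then Q zs else 0) ys"
      using Cons by (intro alt_del_cong) (auto simp: less)
    finally have 1: "alt_del e (alt_del (M x) Q) ys = - alt_del (M x) (\<lambda>zs. if even (length ys) then Q zs else 0) ys" .
    have 2: "alt_del e Q xs = e x * Q ys - (alt_del e (alt_del (M x) Q) ys + (if odd (length ys) then e x * alt_del e Q ys else 0))"
      unfolding Cons alt_del.simps c by (simp add: alt_del_add alt_del_cmult)
    have 3: "alt_del e Q ys = (if odd (length ys) then Q ys else 0)" and 4: "length xs = Suc (length ys)"
      using less Cons by simp_all
    show ?thesis
      unfolding 2 1 3 4 Q_Cons[of x ys, folded Cons] by simp
  qed simp
qed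

text \<open>With d = e' - e, the rows satisfy M' x = M x + d x e - e x d. Along the first row, the
  terms quadratic in d vanish by \<open>alt_del_square\<close> or cancel against the border term;
  contractions by \<open>e\<close> are evaluated by \<open>alt_del_border\<close>.\<close>

lemma rank_two_update:
  assumes "pfaffian_recursion M' e' Q'"
    and M': "\<And>x y. M' x y = M x y + e' x * e y - e x * e' y"
  shows "Q' xs = Q xs + alt_del (\<lambda>x. e' x - e x) Q xs"
proof (induction "length xs" arbitrary: xs rule: less_induct)
  case less
  interpret R: pfaffian_recursion M' e' Q' by fact
  show ?case
  proof (cases xs)
    case Nil
    then show ?thesis by (simp add: Q_Nil R.Q_Nil)
  next
    case (Cons x ys)
    define d where "d = (\<lambda>x. e' x - e x)"
    let ?D = "alt_del d Q"
    have IH: "Q' zs = Q zs + ?D zs" if "length zs < length xs" for zs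
      using less that by (simp add: d_def)
    have split: "alt_del (M' x) R ys = alt_del (M x) R ys + d x * alt_del e R ys - e x * alt_del d R ys" for R
    proof -
      have "M' x = (\<lambda>y. M x y + (d x * e y - e x * d y))"
        by (rule ext) (simp add: M' d_def algebra_simps)
      then show ?thesis by (simp add: alt_del_add_left alt_del_diff_left alt_del_cmult_left)
    qed
    have "alt_del (M' x) Q' ys = alt_del (M' x) (\<lambda>zs. Q zs + ?D zs) ys"
      using Cons by (intro alt_del_cong) (auto simp: IH)
    then have 1: "Q' xs = alt_del (M x) Q ys + alt_del (M x) ?D ys + d x * alt_del e Q ys
        + d x * alt_del e ?D ys - e x * ?D ys
        + (if even (length ys) then (e x + d x) * (Q ys + ?D ys) else 0)"
      by (simp add: Cons R.Q_Cons IH split alt_del_add alt_del_square algebra_simps) (simp add: d_def algebra_simps)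
    have "alt_del e ?D ys = - alt_del d (alt_del e Q) ys"
      by (rule alt_del_anticommute)
    also have "alt_del d (alt_del e Q) ys = alt_del d (\<lambda>zs. if even (length ys) then Q zs else 0) ys"
      by (intro alt_del_cong) (auto simp: alt_del_border)
    finally have 2: "alt_del e ?D ys = (if even (length ys) then - ?D ys else 0)"
      by simp
    have "alt_del d (\<lambda>zs. Q (x # zs)) ys = alt_del d (\<lambda>zs. alt_del (M x) Q zs + (if odd (length ys) then e x * Q zs else 0)) ys"
      by (rule alt_del_cong) (auto simp: Q_Cons)
    also have "\<dots> = - alt_del (M x) ?D ys + (if odd (length ys) then e x * ?D ys else 0)"
      using alt_del_anticommute[of d "M x" Q ys] by (simp add: alt_del_add alt_del_cmult)
    finally have 3: "?D xs = d x * Q ys + alt_del (M x) ?D ys - (if odd (length ys) then e x * ?D ys else 0)"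
      by (simp add: Cons)
    show ?thesis
      unfolding d_def[symmetric] 1 2 3 alt_del_border Q_Cons[of x ys, folded Cons] by (simp add: algebra_simps)
  qed
qed

end

section \<open>The first row expansion of a Pfaffian\<close>

definition matchings :: "nat \<Rightarrow> (nat \<Rightarrow> nat) set" where
  "matchings h = {\<pi>. \<pi> permutes {0..<2 * h} \<and> (\<forall>i<h. \<pi> (2 * i) < \<pi> (2 * i + 1)) \<and>
     (\<forall>i j. i < j \<and> j < h \<longrightarrow> \<pi> (2 * i) < \<pi> (2 * j))}"

lemma matchings_iff:
  "\<pi> \<in> matchings h \<longleftrightarrow> \<pi> permutes {0..<2 * h} \<and> (\<forall>i<h. \<pi> (2 * i) < \<pi> (2 * i + 1)) \<and>
     (\<forall>j<h. \<forall>i<j. \<pi> (2 * i) < \<pi> (2 * j))"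
  by (auto simp: matchings_def)

definition pf_sum :: "nat \<Rightarrow> (nat \<Rightarrow> nat \<Rightarrow> 'a) \<Rightarrow> 'a :: comm_ring_1" where
  "pf_sum h M = (\<Sum>\<pi>\<in>matchings h. signof \<pi> * (\<Prod>i<h. M (\<pi> (2 * i)) (\<pi> (2 * i + 1))))"

text \<open>This adds the pair of 0 and j + 1 to a matching and relabels the old points
  monotonically: the matchings of one summand of the first row expansion.\<close>

definition extend_matching :: "nat \<Rightarrow> (nat \<Rightarrow> nat) \<Rightarrow> nat \<Rightarrow> nat" where
  "extend_matching j \<pi> = permutation_insert 0 0 (permutation_insert 0 j \<pi>)"

lemma extend_matching_simps [simp]:
  "extend_matching j \<pi> 0 = 0"
  "extend_matching j \<pi> (Suc 0) = Suc j"
  "extend_matching j \<pi> (Suc (Suc a)) = Suc (insert_index j (\<pi> a))"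
  by (simp_all add: extend_matching_def permutation_insert_expand insert_index_def)

lemma insert_index_less_iff: "insert_index j a < insert_index j b \<longleftrightarrow> a < b"
  by (auto simp: insert_index_def)

lemma extend_matching_iff:
  assumes "\<pi> permutes {0..<2 * h}" "j < Suc (2 * h)"
  shows "extend_matching j \<pi> \<in> matchings (Suc h) \<longleftrightarrow> \<pi> \<in> matchings h"
proof -
  have "extend_matching j \<pi> permutes {0..<2 * Suc h}"
    unfolding extend_matching_def using assms by (simp add: permutation_insert_permutes)
  then show ?thesis
    using assms(1) by (simp add: matchings_iff All_less_Suc2 insert_index_less_iff)
qed

lemma matchings_0: "\<pi> \<in> matchings (Suc h) \<Longrightarrow> \<pi> 0 = 0"
proof (rule ccontr)
  assume \<pi>: "\<pi> \<in> matchings (Suc h)" and "\<pi> 0 \<noteq> 0"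
  then have "\<pi> permutes {0..<2 * Suc h}" by (simp add: matchings_def)
  then obtain x where x: "x < 2 * Suc h" "\<pi> x = 0"
    by (metis atLeastLessThan_iff le0 permutes_def zero_less_Suc mult_pos_pos zero_less_numeral)
  have less: "\<pi> (2 * i) < \<pi> (2 * i + 1)" "0 < i \<Longrightarrow> \<pi> 0 < \<pi> (2 * i)" if "i < Suc h" for i
    using \<pi> that by (auto simp: matchings_def dest: spec[of _ 0])
  show False
  proof (cases "even x")
    case True
    then obtain i where "x = 2 * i" by (elim evenE)
    then show False using less(2)[of i] x \<open>\<pi> 0 \<noteq> 0\<close> by (cases "i = 0") auto
  next
    case False
    then obtain i where "x = 2 * i + 1" by (elim oddE)
    then show False using less(1)[of i] x by auto
  qed
qed

lemma matchings_Suc: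
  "matchings (Suc h) = (\<lambda>(j, \<pi>). extend_matching j \<pi>) ` ({..<Suc (2 * h)} \<times> matchings h)"
proof (intro equalityI subsetI)
  fix \<pi> assume \<pi>: "\<pi> \<in> matchings (Suc h)"
  then have perm: "\<pi> permutes {0..<Suc (Suc (2 * h))}" by (simp add: matchings_def)
  then have "\<pi> \<in> permutation_insert 0 0 ` {q. q permutes {0..<Suc (2 * h)}}"
    using matchings_0[OF \<pi>] by (subst permutation_fix[symmetric]) auto
  then obtain q where q: "\<pi> = permutation_insert 0 0 q" "q permutes {0..<Suc (2 * h)}" by auto
  then have q0: "q 0 < Suc (2 * h)" using permutes_in_image[of q _ 0] by auto
  with q have "q \<in> permutation_insert 0 (q 0) ` {q. q permutes {0..<2 * h}}"
    by (subst permutation_fix[symmetric]) auto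
  then obtain r where r: "q = permutation_insert 0 (q 0) r" "r permutes {0..<2 * h}" by auto
  then have eq: "\<pi> = extend_matching (q 0) r" using q by (simp add: extend_matching_def)
  then have "r \<in> matchings h" using \<pi> extend_matching_iff[OF r(2) q0] by simp
  then show "\<pi> \<in> (\<lambda>(j, \<pi>). extend_matching j \<pi>) ` ({..<Suc (2 * h)} \<times> matchings h)"
    using eq q0 by auto
next
  fix \<pi> assume "\<pi> \<in> (\<lambda>(j, \<pi>). extend_matching j \<pi>) ` ({..<Suc (2 * h)} \<times> matchings h)"
  then obtain j r where "\<pi> = extend_matching j r" "j < Suc (2 * h)" "r \<in> matchings h" by auto
  then show "\<pi> \<in> matchings (Suc h)"
    using extend_matching_iff[of r h j] by (simp add: matchings_def)
qed

lemma inj_on_extend_matching: "inj_on (\<lambda>(j, \<pi>). extend_matching j \<pi>) A"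
proof (rule inj_onI, clarify)
  fix j i \<pi> \<rho> assume eq: "extend_matching j \<pi> = extend_matching i \<rho>"
  have j: "j = i" using fun_cong[OF eq, of "Suc 0"] by simp
  have "\<pi> a = \<rho> a" for a
    using fun_cong[OF eq, of "Suc (Suc a)"] j by (metis delete_insert_index extend_matching_simps(3) nat.inject)
  then show "j = i \<and> \<pi> = \<rho>" using j by auto
qed

lemma pf_sum_Suc:
  "pf_sum (Suc h) M = (\<Sum>j<Suc (2 * h). (- 1) ^ j * M 0 (Suc j) *
     pf_sum h (\<lambda>a b. M (Suc (insert_index j a)) (Suc (insert_index j b))))"
proof -
  \<comment> \<open>Inserting the value j at place 0 contributes (-1)^j, and inserting 0 at place 0
    contributes nothing.\<close>
  have sign: "signof (extend_matching j \<pi>) = ((- 1) ^ j * signof \<pi> :: 'a)"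
    if "j < Suc (2 * h)" "\<pi> \<in> matchings h" for j \<pi>
  proof -
    have \<pi>: "\<pi> permutes {0..<2 * h}" using that by (simp add: matchings_def)
    show ?thesis
      unfolding extend_matching_def
      using signof_permutation_insert[OF permutation_insert_permutes[OF \<pi>, of 0 j], of 0 0, where ?'a = 'a]
        signof_permutation_insert[OF \<pi>, of 0 j, where ?'a = 'a] that by simp
  qed
  have "pf_sum (Suc h) M = (\<Sum>(j, \<pi>)\<in>{..<Suc (2 * h)} \<times> matchings h. signof (extend_matching j \<pi>) *
      (\<Prod>i<Suc h. M (extend_matching j \<pi> (2 * i)) (extend_matching j \<pi> (2 * i + 1))))"
    unfolding pf_sum_def matchings_Suc
    by (subst sum.reindex[OF inj_on_extend_matching]) (simp add: case_prod_unfold)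
  also have "\<dots> = (\<Sum>(j, \<pi>)\<in>{..<Suc (2 * h)} \<times> matchings h. (- 1) ^ j * signof \<pi> *
      (M 0 (Suc j) * (\<Prod>i<h. M (Suc (insert_index j (\<pi> (2 * i)))) (Suc (insert_index j (\<pi> (2 * i + 1)))))))"
    by (intro sum.cong refl) (auto simp: sign prod.lessThan_Suc_shift simp del: prod.lessThan_Suc)
  finally show ?thesis
    by (simp add: pf_sum_def sum_distrib_left mult_ac flip: sum.cartesian_product)
qed

definition pf_list :: "('b \<Rightarrow> 'b \<Rightarrow> 'a) \<Rightarrow> 'b list \<Rightarrow> 'a :: comm_ring_1" where
  "pf_list M xs = pf_sum (length xs div 2) (\<lambda>a b. M (xs ! a) (xs ! b))"

lemma pf_sum_cong:
  assumes "\<And>a b. a < b \<Longrightarrow> b < 2 * h \<Longrightarrow> M a b = N a b"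
  shows "pf_sum h M = pf_sum h N"
  unfolding pf_sum_def
proof (intro sum.cong arg_cong2[where f = "(*)"] prod.cong refl)
  fix \<pi> i assume "\<pi> \<in> matchings h" "i \<in> {..<h}"
  then show "M (\<pi> (2 * i)) (\<pi> (2 * i + 1)) = N (\<pi> (2 * i)) (\<pi> (2 * i + 1))"
    using permutes_in_image[of \<pi> "{0..<2 * h}" "2 * i + 1"] by (intro assms) (auto simp: matchings_def)
qed

lemma pf_list_Nil: "pf_list M [] = 1"
proof -
  have "matchings 0 = {id}" by (auto simp: matchings_def)
  then show ?thesis by (simp add: pf_list_def pf_sum_def)
qed

lemma pf_list_Cons:
  assumes "odd (length xs)"
  shows "pf_list M (x # xs) = alt_del (M x) (pf_list M) xs"
proof -
  obtain h where h: "length xs = 2 * h + 1" using assms by (elim oddE)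
  have "pf_sum h (\<lambda>a b. M (xs ! insert_index j a) (xs ! insert_index j b)) =
      pf_list M (take j xs @ drop (Suc j) xs)" if "j < Suc (2 * h)" for j
  proof -
    have "(take j xs @ drop (Suc j) xs) ! a = xs ! insert_index j a" if "a < 2 * h" for a
      using \<open>j < Suc (2 * h)\<close> that h by (auto simp: nth_append insert_index_def)
    then show ?thesis
      using that h by (auto simp: pf_list_def intro!: pf_sum_cong)
  qed
  then show ?thesis
    using h by (simp add: alt_del_eq_sum pf_list_def[of M "x # xs"] pf_sum_Suc del: sum.lessThan_Suc)
qed

lemma pfaffian_eq_pf_list:
  assumes "even (length xs)" "\<And>p q. p < q \<Longrightarrow> q < length xs \<Longrightarrow> f (p, q) = M (xs ! p) (xs ! q)"
  shows "pfaffian (mat (length xs) (length xs) f) = pf_list M xs"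
proof -
  obtain h where h: "length xs = 2 * h" using assms by (elim evenE)
  have "pfaffian (mat (length xs) (length xs) f) = pf_sum h (\<lambda>a b. mat (2 * h) (2 * h) f $$ (a, b))"
    by (simp add: pfaffian_def pf_sum_def matchings_def h)
  also have "\<dots> = pf_list M xs"
    unfolding pf_list_def h using assms(2) by (auto simp: h intro!: pf_sum_cong)
  finally show ?thesis .
qed

section \<open>The Q-tilde polynomials as bordered Pfaffians\<close>

lemma elem_sym_0 [simp]: "elem_sym n 0 = 1"
proof -
  have "{S. S \<subseteq> {1..n} \<and> card S = 0} = {{}}" by (auto dest: finite_subset)
  then show ?thesis by (simp add: elem_sym_def)
qed

lemma Qt2_0: "Qt2 n i 0 = elem_sym n i"
  by (simp add: Qt2_def)

lemma Qt_eq_pf_list: "Qt n I = pf_list (Qt2 n) (if even (length I) then I else I @ [0])"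
  unfolding Qt_def Let_def by (rule pfaffian_eq_pf_list) auto

text \<open>The appended part 0 is the additional index of the recursion, because its column
  consists of the \<open>Qt2 n x 0\<close>, that is, of the elementary symmetric
  polynomials.\<close>

interpretation Qt: pfaffian_recursion "Qt2 n" "elem_sym n" "Qt n" for n
proof
  show "Qt n [] = 1" by (simp add: Qt_eq_pf_list pf_list_Nil)
  show "Qt n (x # xs) = alt_del (Qt2 n x) (Qt n) xs + (if even (length xs) then elem_sym n x * Qt n xs else 0)"
    for x xs
  proof (cases "even (length xs)")
    case True
    have "Qt n (x # xs) = alt_del (Qt2 n x) (pf_list (Qt2 n)) (xs @ [0])"
      using True by (simp add: Qt_eq_pf_list pf_list_Cons)
    also have "\<dots> = alt_del (Qt2 n x) (\<lambda>ys. pf_list (Qt2 n) (ys @ [0])) xs + elem_sym n x * pf_list (Qt2 n) xs"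
      using True by (simp add: alt_del_snoc Qt2_0)
    also have "alt_del (Qt2 n x) (\<lambda>ys. pf_list (Qt2 n) (ys @ [0])) xs = alt_del (Qt2 n x) (Qt n) xs"
      using True by (intro alt_del_cong) (auto simp: Qt_eq_pf_list)
    also have "pf_list (Qt2 n) xs = Qt n xs"
      using True by (simp add: Qt_eq_pf_list)
    finally show ?thesis using True by simp
  next
    case False
    have "Qt n (x # xs) = alt_del (Qt2 n x) (pf_list (Qt2 n)) xs"
      using False by (simp add: Qt_eq_pf_list pf_list_Cons)
    also have "\<dots> = alt_del (Qt2 n x) (Qt n) xs"
      using False by (intro alt_del_cong) (auto simp: Qt_eq_pf_list)
    finally show ?thesis using False by simp
  qed
qed

section \<open>The operator on Q-tilde polynomials\<close>

text \<open>A general set of variables is allowed so that \<open>x_1\<close> can be split off,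
  leaving \<open>{2..n}\<close>.\<close>

definition esym :: "nat set \<Rightarrow> nat \<Rightarrow> 'a :: comm_ring_1 mpoly" where
  "esym A i = (\<Sum>S | S \<subseteq> A \<and> card S = i. \<Prod>v\<in>S. X v)"

lemma elem_sym_eq_esym: "elem_sym n = esym {1..n}"
  by (rule ext) (simp add: elem_sym_def esym_def)

lemma esym_0: "finite A \<Longrightarrow> esym A 0 = 1"
proof -
  assume "finite A"
  then have "{S. S \<subseteq> A \<and> card S = 0} = {{}}" by (auto dest: finite_subset)
  then show ?thesis by (simp add: esym_def)
qed

lemma esym_eq_0: "finite A \<Longrightarrow> card A < i \<Longrightarrow> esym A i = 0"
proof -
  assume "finite A" "card A < i"
  then have "{S. S \<subseteq> A \<and> card S = i} = {}" by (auto dest: card_mono)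
  then show ?thesis by (simp only: esym_def sum.empty)
qed

lemma esym_insert:
  assumes "finite A" "v \<notin> A"
  shows "esym (insert v A) (Suc i) = (esym A (Suc i) + X v * esym A i :: 'a :: comm_ring_1 mpoly)"
proof -
  let ?P = "\<lambda>A i. {S. S \<subseteq> A \<and> card S = i}"
  have fin: "finite S" if "S \<subseteq> A" for S using assms that finite_subset by blast
  have "?P (insert v A) (Suc i) = ?P A (Suc i) \<union> insert v ` ?P A i"
  proof (intro Set.set_eqI iffI)
    fix S assume S: "S \<in> ?P (insert v A) (Suc i)"
    show "S \<in> ?P A (Suc i) \<union> insert v ` ?P A i"
    proof (cases "v \<in> S")
      case True
      then have "S = insert v (S - {v})" "S - {v} \<in> ?P A i" using S by auto
      then show ?thesis by blast
    qed (use S in auto)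
  qed (use assms(2) fin in \<open>auto simp: card_insert_if\<close>)
  moreover have "?P A (Suc i) \<inter> insert v ` ?P A i = {}" using assms(2) by auto
  moreover have "finite (?P A j)" for j using assms(1) by simp
  moreover have "inj_on (insert v) (?P A i)"
    using assms(2) by (intro inj_onI) (metis (mono_tags, lifting) insert_ident mem_Collect_eq subsetD)
  moreover have "(\<Prod>w\<in>insert v S. X w) = (X v * (\<Prod>w\<in>S. X w) :: 'a mpoly)" if "S \<in> ?P A i" for S
    using that assms finite_subset by (subst prod.insert) auto
  ultimately show ?thesis
    by (simp add: esym_def sum.union_disjoint sum.reindex sum_distrib_left)
qed

lemma reflect_esym:
  assumes "0 < i" "i \<in> A \<longleftrightarrow> Suc i \<in> A"
  shows "reflect i (esym A j) = (esym A j :: 'a :: comm_ring_1 mpoly)"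
proof -
  let ?t = "transpose i (Suc i)"
  have X: "reflect i (X v) = (X (?t v) :: 'a mpoly)" for v
    using assms by (simp add: reflect_X transpose_def)
  have "reflect i (\<Prod>v\<in>S. X v) = (\<Prod>v\<in>?t ` S. X v :: 'a mpoly)" for S
    by (simp add: reflect_prod X prod.reindex)
  then have "reflect i (esym A j) = (\<Sum>S | S \<subseteq> A \<and> card S = j. \<Prod>v\<in>?t ` S. X v :: 'a mpoly)"
    by (simp add: esym_def reflect_sum)
  also have "\<dots> = esym A j"
    unfolding esym_def
  proof (rule sum.reindex_bij_witness[where i = "image ?t" and j = "image ?t"])
    have "?t v \<in> A" if "v \<in> A" for v using that assms by (auto simp: transpose_def)
    then show "?t ` S \<in> {S. S \<subseteq> A \<and> card S = j}" if "S \<in> {S. S \<subseteq> A \<and> card S = j}" for S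
      using that by (auto simp: card_image)
    then show "?t ` S \<in> {S. S \<subseteq> A \<and> card S = j}" if "S \<in> {S. S \<subseteq> A \<and> card S = j}" for S
      using that .
  qed (simp_all add: image_image)
  finally show ?thesis .
qed

lemma reflect_elem_sym: "1 \<le> i \<Longrightarrow> i < n \<Longrightarrow> reflect i (elem_sym n j) = elem_sym n j"
  unfolding elem_sym_eq_esym by (rule reflect_esym) auto

lemma reflect_0_esym: "1 \<notin> A \<Longrightarrow> reflect 0 (esym A j) = esym A j"
  unfolding esym_def reflect_sum reflect_prod
  by (intro sum.cong prod.cong) (auto simp: reflect_X)

lemma elem_sym_Suc: "1 \<le> n \<Longrightarrow> elem_sym n (Suc i) = esym {2..n} (Suc i) + X 1 * esym {2..n} i"
proof -
  assume "1 \<le> n"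
  then have "{1..n} = insert 1 {2..n}" by auto
  then show ?thesis by (simp add: elem_sym_eq_esym esym_insert)
qed

section \<open>The change of sign of the first variable\<close>

lemma Qt2_Suc:
  "Qt2 n i (Suc j) + Qt2 n (Suc i) j = elem_sym n i * elem_sym n (Suc j) - elem_sym n (Suc i) * elem_sym n j"
proof -
  let ?f = "\<lambda>p. (- 1) ^ p * elem_sym n (Suc i + p) * elem_sym n (j - p) :: 'a mpoly"
  have "(\<Sum>p = 1..Suc j. (- 1) ^ p * elem_sym n (i + p) * elem_sym n (Suc j - p)) = - (\<Sum>p = 0..j. ?f p)"
    unfolding One_nat_def sum.shift_bounds_cl_Suc_ivl by (simp add: sum_negf)
  also have "(\<Sum>p = 0..j. ?f p) = elem_sym n (Suc i) * elem_sym n j + (\<Sum>p = 1..j. ?f p)"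
    by (simp add: sum.atLeast_Suc_atMost)
  finally have eq: "(\<Sum>p = 1..Suc j. (- 1) ^ p * elem_sym n (i + p) * elem_sym n (Suc j - p)) =
      - (elem_sym n (Suc i) * elem_sym n j + (\<Sum>p = 1..j. ?f p))" .
  show ?thesis
    unfolding Qt2_def eq by (simp add: algebra_simps)
qed

text \<open>This is the hypothesis of \<open>rank_two_update\<close> for the reflected entries.
  \<open>Qt2_Suc\<close> lowers the second index, and the step works because e_(i+1) minus its
  reflection is \<open>x_1\<close> times the sum of e_i and its reflection, for every i.\<close>

lemma reflect_0_Qt2:
  assumes "1 \<le> n"
  shows "reflect 0 (Qt2 n i j) = Qt2 n i j + reflect 0 (elem_sym n i) * elem_sym n j - elem_sym n i * reflect 0 (elem_sym n j)"
proof (induction j arbitrary: i)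
  case (Suc j)
  let ?e = "elem_sym n :: nat \<Rightarrow> 'a mpoly" and ?r = "reflect 0 :: 'a mpoly \<Rightarrow> _"
  have Q: "Qt2 n i (Suc j) = ?e i * ?e (Suc j) - ?e (Suc i) * ?e j - Qt2 n (Suc i) j"
    using Qt2_Suc[of n i j] by (simp add: algebra_simps)
  have diff: "?e (Suc i) - ?r (?e (Suc i)) = X 1 * (?e i + ?r (?e i))" for i
    using assms by (cases i) (simp_all add: elem_sym_Suc reflect_X reflect_0_esym esym_0 algebra_simps)
  have "(?e i + ?r (?e i)) * (?e (Suc j) - ?r (?e (Suc j))) = (?e (Suc i) - ?r (?e (Suc i))) * (?e j + ?r (?e j))"
    by (simp only: diff mult_ac)
  then show ?case
    unfolding Q reflect_diff reflect_mult Suc by (simp add: algebra_simps)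
qed (simp add: Qt2_0)

lemma pfaffian_recursion_reflect:
  "pfaffian_recursion (\<lambda>x y. reflect i (Qt2 n x y)) (\<lambda>x. reflect i (elem_sym n x)) (\<lambda>xs. reflect i (Qt n xs))"
  by unfold_locales (auto simp: Qt.Q_Nil Qt.Q_Cons alt_del_hom[of "reflect i"])

lemma reflect_Qt:
  assumes "1 \<le> i" "i < n"
  shows "reflect i (Qt n I) = Qt n I"
proof -
  have "reflect i (Qt n I) = Qt n I + alt_del (\<lambda>x. reflect i (elem_sym n x) - elem_sym n x) (Qt n) I"
    using assms by (intro Qt.rank_two_update[OF pfaffian_recursion_reflect])
      (simp add: Qt2_def reflect_sum reflect_elem_sym)
  then show ?thesis using assms by (simp add: reflect_elem_sym alt_del_zero)
qed

text \<open>If n is positive and I has no part 0, then -2 times this is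
  \<open>ddiff 0 (Qt n I)\<close>; in this form it shows the removed parts.\<close>

definition Qt_der :: "nat \<Rightarrow> nat list \<Rightarrow> 'a :: comm_ring_1 mpoly" where
  "Qt_der n I = alt_del (\<lambda>x. esym {2..n} (x - 1)) (Qt n) I"

lemma reflect_0_Qt:
  assumes "1 \<le> n" "0 \<notin> set I"
  shows "reflect 0 (Qt n I) = Qt n I - 2 * X 1 * Qt_der n I"
proof -
  have "reflect 0 (Qt n I) = Qt n I + alt_del (\<lambda>x. reflect 0 (elem_sym n x) - elem_sym n x) (Qt n) I"
    by (rule Qt.rank_two_update[OF pfaffian_recursion_reflect]) (rule reflect_0_Qt2[OF assms(1)])
  also have "alt_del (\<lambda>x. reflect 0 (elem_sym n x) - elem_sym n x) (Qt n) I =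
      alt_del (\<lambda>x. (- 2 * X 1) * esym {2..n} (x - 1)) (Qt n) I"
  proof (rule alt_del_cong)
    fix x assume "x \<in> set I"
    then have "x \<noteq> 0" using assms(2) by metis
    then obtain y where "x = Suc y" using not0_implies_Suc by blast
    then show "reflect 0 (elem_sym n x) - elem_sym n x = (- 2 * X 1) * esym {2..n} (x - 1)"
      using assms(1) by (simp add: elem_sym_Suc reflect_X reflect_0_esym)
  qed simp
  finally show ?thesis by (simp only: alt_del_cmult_left Qt_der_def) simp
qed

lemma ddiff_0_X_power_Qt:
  assumes "1 \<le> n" "0 \<notin> set I"
  shows "ddiff 0 (X 1 ^ m * Qt n I :: 'a :: idom mpoly) =
    ((- 1) ^ m - 1) * (X 1 ^ (m - 1) * Qt n I) - 2 * (- 1) ^ m * (X 1 ^ m * Qt_der n I)"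
proof (rule ddiff_eqI)
  \<comment> \<open>For m = 0 the truncated exponent m - 1 is harmless, since the coefficient
    vanishes.\<close>
  have 1: "((- 1) ^ m - 1) * X 1 ^ m = ((- 1) ^ m - 1 :: 'a mpoly) * X 1 ^ (m - 1) * X 1"
    by (cases m) simp_all
  have 2: "(- X 1) ^ m = ((- 1) ^ m * X 1 ^ m :: 'a mpoly)"
    by (rule power_minus)
  have "(((- 1) ^ m - 1) * (X 1 ^ (m - 1) * Qt n I) - 2 * (- 1) ^ m * (X 1 ^ m * Qt_der n I)) * ddiff_denom 0 =
      - (((- 1) ^ m - 1) * X 1 ^ (m - 1) * X 1) * Qt n I + 2 * (- 1) ^ m * (X 1 ^ m * (X 1 * Qt_der n I :: 'a mpoly))"
    by (simp add: ddiff_denom_def algebra_simps)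
  also have "\<dots> = X 1 ^ m * Qt n I - (- X 1) ^ m * (Qt n I - 2 * X 1 * Qt_der n I)"
    unfolding 1[symmetric] 2 by (simp add: algebra_simps)
  also have "\<dots> = X 1 ^ m * Qt n I - reflect 0 (X 1 ^ m * Qt n I)"
    using assms by (simp add: reflect_0_Qt reflect_X)
  finally show "(((- 1) ^ m - 1) * (X 1 ^ (m - 1) * Qt n I) - 2 * (- 1) ^ m * (X 1 ^ m * Qt_der n I)) * ddiff_denom 0 =
      X 1 ^ m * Qt n I - reflect 0 (X 1 ^ m * Qt n I :: 'a mpoly)" .
qed

section \<open>Multiplication by a power of the first variable followed by \<sigma>\<close>

lemma fold_ddiff_alt_del:
  fixes Q :: "nat list \<Rightarrow> 'a :: idom mpoly"
  assumes "\<And>i ys. i \<in> set ws \<Longrightarrow> reflect i (Q ys) = Q ys"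
  shows "fold ddiff ws (c * alt_del u Q xs) = alt_del (\<lambda>x. fold ddiff ws (c * u x)) Q xs"
  using assms
proof (induction xs arbitrary: Q)
  case (Cons x xs)
  have "fold ddiff ws (c * alt_del u Q (x # xs)) = fold ddiff ws (Q xs * (c * u x)) - fold ddiff ws (c * alt_del u (\<lambda>ys. Q (x # ys)) xs)"
    by (simp add: algebra_simps fold_ddiff_diff)
  also have "fold ddiff ws (Q xs * (c * u x)) = Q xs * fold ddiff ws (c * u x)"
    using Cons.prems by (rule fold_ddiff_mult_invariant)
  also have "fold ddiff ws (c * alt_del u (\<lambda>ys. Q (x # ys)) xs) = alt_del (\<lambda>x. fold ddiff ws (c * u x)) (\<lambda>ys. Q (x # ys)) xs"
    using Cons.prems by (intro Cons.IH)
  finally show ?case by simp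
qed simp

context
  fixes n :: nat and g :: "nat \<Rightarrow> nat \<Rightarrow> 'a :: idom mpoly"
  assumes n: "1 \<le> n"
  defines "g \<equiv> \<lambda>m j. fold ddiff [1..<n] (X 1 ^ m * esym {2..n} j)"
begin

lemma fold_ddiff_X_1_power: "m < n \<Longrightarrow> fold ddiff [1..<n] (X 1 ^ m) = (if Suc m = n then 1 else 0 :: 'a mpoly)"
  using fold_ddiff_upt_X_power[of 1 m "n - 1", where ?'a = 'a] n by (auto simp: le_diff_conv2)

lemma fold_ddiff_esym_0: "m < n \<Longrightarrow> g m 0 = (if Suc m = n then 1 else 0)"
  using fold_ddiff_X_1_power[of m] by (simp add: g_def esym_0)

text \<open>The two products add up to a power of \<open>x_1\<close> times an elementary symmetric
  polynomial in all n variables, which passes through the word. This recursion in m and j determines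
  all required values.\<close>

lemma fold_ddiff_esym_Suc: "m < n \<Longrightarrow> g m (Suc j) + g (Suc m) j = (if Suc m = n then elem_sym n (Suc j) else 0)"
proof -
  assume m: "m < n"
  have "g m (Suc j) + g (Suc m) j = fold ddiff [1..<n] (elem_sym n (Suc j) * X 1 ^ m)"
    unfolding g_def fold_ddiff_add[symmetric] elem_sym_Suc[OF n] by (simp add: algebra_simps)
  also have "\<dots> = elem_sym n (Suc j) * fold ddiff [1..<n] (X 1 ^ m)"
    by (rule fold_ddiff_mult_invariant) (simp add: reflect_elem_sym)
  finally show ?thesis using fold_ddiff_X_1_power[OF m] by simp
qed

lemma fold_ddiff_esym_low: "m + j < n \<Longrightarrow> g m j = (if Suc (m + j) = n then (- 1) ^ j else 0)"
proof (induction j arbitrary: m)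
  case 0
  then show ?case by (simp add: fold_ddiff_esym_0)
next
  case (Suc j)
  then show ?case using fold_ddiff_esym_Suc[of m j] by (auto simp: eq_neg_iff_add_eq_0 split: if_splits)
qed

text \<open>Together with \<open>fold_ddiff_esym_low\<close>: for m < n only j = n - 1 - m gives a
  nonzero value, so only the part n - m can be removed. For m = n the border of the Pfaffian
  reappears, to which \<open>alt_del_border\<close> applies.\<close>

lemma fold_ddiff_esym_high: "m \<le> n \<Longrightarrow> n \<le> m + j \<Longrightarrow> g m j = (if m = n then elem_sym n (Suc j) else 0)"
proof (induction m arbitrary: j)
  case 0
  then show ?case using n by (simp add: g_def esym_eq_0)
next
  case (Suc m)
  then show ?case using fold_ddiff_esym_Suc[of m j] by simp
qed

lemma sig_X_power_Qt_aux:
  assumes "0 \<notin> set I" "m \<le> n"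
  shows "sig n (X 1 ^ m * Qt n I) =
    (if m = n then ((- 1) ^ n - 1) * Qt n I else 0) - 2 * (- 1) ^ m * alt_del (\<lambda>x. g m (x - 1)) (Qt n) I"
proof -
  let ?F = "fold ddiff [1..<n] :: 'a mpoly \<Rightarrow> _"
  have Q: "?F (X 1 ^ (m - 1) * Qt n I) = Qt n I * ?F (X 1 ^ (m - 1))"
    unfolding mult.commute[of "X 1 ^ _"] by (rule fold_ddiff_mult_invariant) (simp add: reflect_Qt)
  have "[0..<n] = 0 # [1..<n]" using n by (simp add: upt_conv_Cons)
  then have "sig n (X 1 ^ m * Qt n I) = ?F (ddiff 0 (X 1 ^ m * Qt n I))"
    by (simp add: sig_def)
  also have "\<dots> = ?F (((- 1) ^ m - 1) * (X 1 ^ (m - 1) * Qt n I)) - ?F (2 * (- 1) ^ m * (X 1 ^ m * Qt_der n I))"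
    by (simp only: ddiff_0_X_power_Qt[OF n assms(1)] fold_ddiff_diff)
  also have "?F (((- 1) ^ m - 1) * (X 1 ^ (m - 1) * Qt n I)) = ((- 1) ^ m - 1) * (Qt n I * ?F (X 1 ^ (m - 1)))"
    by (subst fold_ddiff_mult_invariant) (simp_all add: Q[simplified])
  \<comment> \<open>The word has n - 1 letters, so it kills the power m - 1 of \<open>X 1\<close>
    unless m = n.\<close>
  also have "\<dots> = (if m = n then ((- 1) ^ n - 1) * Qt n I else 0)"
  proof (cases "m = 0")
    case False
    then show ?thesis using fold_ddiff_X_1_power[of "m - 1"] assms n by auto
  qed (use n in simp)
  also have "?F (2 * (- 1) ^ m * (X 1 ^ m * Qt_der n I)) = 2 * (- 1) ^ m * ?F (X 1 ^ m * Qt_der n I)"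
    by (rule fold_ddiff_mult_invariant) simp
  also have "?F (X 1 ^ m * Qt_der n I) = alt_del (\<lambda>x. g m (x - 1)) (Qt n) I"
    unfolding Qt_der_def g_def by (rule fold_ddiff_alt_del) (simp add: reflect_Qt)
  finally show ?thesis .
qed

end

lemma sig_X_power_Qt:
  assumes "1 \<le> n" "0 \<notin> set I" "m < n"
  shows "sig n (X 1 ^ m * Qt n I :: 'a :: idom mpoly) =
    2 * (- 1) ^ n * alt_del (\<lambda>x. if x = n - m then 1 else 0) (Qt n) I"
proof -
  let ?g = "\<lambda>m j. fold ddiff [1..<n] (X 1 ^ m * esym {2..n} j) :: 'a mpoly"
  have "alt_del (\<lambda>x. ?g m (x - 1)) (Qt n) I = alt_del (\<lambda>x. (- 1) ^ (n - m - 1) * (if x = n - m then 1 else 0)) (Qt n) I"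
  proof (rule alt_del_cong)
    fix x assume "x \<in> set I"
    then have "0 < x" using assms(2) by (metis gr0I)
    then show "?g m (x - 1) = (- 1) ^ (n - m - 1) * (if x = n - m then 1 else 0)"
      using assms fold_ddiff_esym_low[of n m "x - 1", where ?'a = 'a] fold_ddiff_esym_high[of n m "x - 1", where ?'a = 'a]
      by (cases "m + (x - 1) < n") auto
  qed simp
  then have "sig n (X 1 ^ m * Qt n I :: 'a mpoly) = 2 * (- ((- 1) ^ m * (- 1) ^ (n - m - 1))) *
      alt_del (\<lambda>x. if x = n - m then 1 else 0) (Qt n) I"
    using sig_X_power_Qt_aux[of n I m, where ?'a = 'a] assms
    by (simp add: alt_del_cmult_left mult.assoc)
  also have "- ((- 1) ^ m * (- 1) ^ (n - m - 1)) = ((- 1) ^ n :: 'a mpoly)"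
  proof -
    have "n = Suc (m + (n - m - 1))" using assms by simp
    then show ?thesis by (metis mult_minus1 power_Suc power_add)
  qed
  finally show ?thesis .
qed

text \<open>By \<open>alt_del_border\<close> the factor is (-1)^n - 1 if the length of I is even and
  (-1)^n - 1 - 2 (-1)^n if it is odd; this is -2 or 0 according to the parities.\<close>

lemma sig_X_power_n_Qt:
  assumes "1 \<le> n" "0 \<notin> set I"
  shows "sig n (X 1 ^ n * Qt n I :: 'a :: idom mpoly) =
    (if length I mod 2 \<noteq> n mod 2 then - 2 * Qt n I else 0)"
proof -
  let ?g = "\<lambda>m j. fold ddiff [1..<n] (X 1 ^ m * esym {2..n} j) :: 'a mpoly"
  have "alt_del (\<lambda>x. ?g n (x - 1)) (Qt n) I = alt_del (elem_sym n) (Qt n) I"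
  proof (rule alt_del_cong)
    fix x assume "x \<in> set I"
    then have "0 < x" using assms(2) by (metis gr0I)
    then show "?g n (x - 1) = elem_sym n x"
      using assms fold_ddiff_esym_high[of n n "x - 1", where ?'a = 'a] by simp
  qed simp
  then show ?thesis
    using sig_X_power_Qt_aux[of n I n, where ?'a = 'a] assms
    by (auto simp: Qt.alt_del_border mod2_eq_if)
qed

section \<open>Iterated removal of parts\<close>

lemma fold_sig_cmult:
  fixes c :: "'a :: idom mpoly"
  assumes "\<And>i. reflect i c = c"
  shows "fold (\<lambda>b G. sig n (X 1 ^ b * G)) bs (c * G) = c * fold (\<lambda>b G. sig n (X 1 ^ b * G)) bs G"
proof (induction bs arbitrary: G)
  case (Cons b bs)
  have "sig n (X 1 ^ b * (c * G)) = c * sig n (X 1 ^ b * G)"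
    unfolding sig_def mult.left_commute[of "X 1 ^ b" c] by (rule fold_ddiff_mult_invariant) (rule assms)
  then show ?case using Cons by simp
qed simp

section \<open>Signs and positions of the erased parts\<close>

lemma alt_del_indicator:
  assumes "c \<notin> set A" "c \<notin> set B"
  shows "alt_del (\<lambda>x. if x = c then 1 else 0) Q (A @ c # B) = (- 1) ^ length A * Q (A @ B)"
proof -
  have "alt_del (\<lambda>x. if x = c then 1 else 0) (\<lambda>ys. Q (ys @ c # B)) A = 0"
    and "alt_del (\<lambda>x. if x = c then 1 else 0) (\<lambda>ys. Q (A @ c # ys)) B = 0"
    using assms by (auto intro: alt_del_zero)
  then show ?thesis by (simp add: alt_del_append)
qed

lemma position_sum_eq: "position_sum E I = (\<Sum>r | r < length I \<and> int (I ! r) \<in> E. Suc r)"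
  unfolding position_sum_def
  by (rule sum.reindex_bij_witness[where i = Suc and j = "\<lambda>p. p - 1"]) auto

lemma position_sum_append:
  assumes "\<And>x. x \<in> set B \<Longrightarrow> int x \<notin> E"
  shows "position_sum E (A @ B) = position_sum E A"
proof -
  have "int (B ! (r - length A)) \<notin> E" if "\<not> r < length A" "r < length A + length B" for r
    using assms that by simp
  then have "{r. r < length (A @ B) \<and> int ((A @ B) ! r) \<in> E} = {r. r < length A \<and> int (A ! r) \<in> E}"
    by (auto simp: nth_append)
  then show ?thesis by (simp only: position_sum_eq)
qed

lemma position_sum_snoc:
  assumes "int c \<notin> E" "c \<notin> set A"
  shows "position_sum (insert (int c) E) (A @ [c]) = Suc (length A) + position_sum E A"
proof -
  have "{r. r < length (A @ [c]) \<and> int ((A @ [c]) ! r) \<in> insert (int c) E} =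
      insert (length A) {r. r < length A \<and> int (A ! r) \<in> E}"
    using assms by (auto simp: nth_append less_Suc_eq)
  then show ?thesis by (simp add: position_sum_eq)
qed

text \<open>Decreasing exponents erase increasing parts. Each removal therefore takes place to the
  right of all later ones and leaves their positions unchanged; it contributes 2 (-1)^n (-1)^(p-1)
  for the position p in the original list.\<close>

lemma fold_sig_Qt:
  assumes n: "1 \<le> n" and "sorted_wrt (>) bs" "\<And>b. b \<in> set bs \<Longrightarrow> b < n"
    and "sorted_wrt (>) I" "0 \<notin> set I"
  defines "E \<equiv> \<lambda>bs. (\<lambda>b. int n - int b) ` set bs"
  shows "fold (\<lambda>b G. sig n (X 1 ^ b * G)) bs (Qt n I) =
    (if E bs \<subseteq> int ` set I
     then 2 ^ length bs * (- 1) ^ (Suc n * length bs + position_sum (E bs) I) * Qt n (remaining_parts (E bs) I)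
     else 0 :: 'a :: idom mpoly)"
  using assms(2-5)
proof (induction bs arbitrary: I)
  case Nil
  have "position_sum {} I = 0" "remaining_parts {} I = I"
    by (simp_all add: position_sum_eq remaining_parts_def)
  then show ?case by (simp add: E_def)
next
  case (Cons b bs)
  let ?D = "fold (\<lambda>b G. sig n (X 1 ^ b * G)) bs :: 'a mpoly \<Rightarrow> _"
  define c where "c = n - b"
  have b: "b < n" using Cons.prems by simp
  then have c_int: "int n - int b = int c" by (simp add: c_def)
  have E_Cons: "E (b # bs) = insert (int c) (E bs)" by (simp add: E_def c_int)
  have E_greater: "int c < e" if "e \<in> E bs" for e
    using that Cons.prems(1) by (auto simp: E_def simp flip: c_int)
  have step: "sig n (X 1 ^ b * Qt n I) = (2 * (- 1) ^ n * alt_del (\<lambda>x. if x = c then 1 else 0) (Qt n) I :: 'a mpoly)"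
    unfolding c_def using n Cons.prems(4) b by (rule sig_X_power_Qt)
  show ?case
  proof (cases "c \<in> set I")
    case False
    then have "alt_del (\<lambda>x. if x = c then 1 else 0) (Qt n) I = (0 :: 'a mpoly)"
      by (intro alt_del_zero) auto
    moreover have "?D 0 = 0" by (induction bs) simp_all
    ultimately have "fold (\<lambda>b G. sig n (X 1 ^ b * G)) (b # bs) (Qt n I) = (0 :: 'a mpoly)"
      unfolding fold_Cons o_apply step by simp
    moreover have "\<not> E (b # bs) \<subseteq> int ` set I" using False by (auto simp: E_Cons)
    ultimately show ?thesis by (simp only: if_False)
  next
    case True
    then obtain A B where I: "I = A @ c # B" by (auto dest: split_list)
    have A: "x \<in> set A \<Longrightarrow> c < x" and B: "x \<in> set B \<Longrightarrow> x < c" for x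
      using Cons.prems(3) by (auto simp: I sorted_wrt_append)
    have c_E: "int c \<notin> E bs" using E_greater[of "int c"] by auto
    have "c \<notin> set A" using A by blast
    note snoc = position_sum_snoc[OF c_E this]
    \<comment> \<open>The entries behind \<open>c\<close> are smaller than \<open>c\<close>, while
      all parts still to be erased are larger.\<close>
    have B_E: "int x \<notin> E bs" "int x \<notin> E (b # bs)" if "x \<in> set B" for x
      using B[OF that] E_greater[of "int x"] by (auto simp: E_Cons)
    have sub: "E (b # bs) \<subseteq> int ` set I \<longleftrightarrow> E bs \<subseteq> int ` set (A @ B)"
      using c_E by (auto simp: E_Cons I)
    have "position_sum (E (b # bs)) I = position_sum (E (b # bs)) ((A @ [c]) @ B)"
      by (simp add: I)
    also have "\<dots> = position_sum (E (b # bs)) (A @ [c])"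
      by (rule position_sum_append) (rule B_E)
    also have "\<dots> = Suc (length A) + position_sum (E bs) A"
      unfolding E_Cons by (rule snoc)
    also have "position_sum (E bs) A = position_sum (E bs) (A @ B)"
      by (rule position_sum_append[symmetric]) (rule B_E)
    finally have pos: "position_sum (E (b # bs)) I = Suc (length A) + position_sum (E bs) (A @ B)" .
    have rem: "remaining_parts (E (b # bs)) I = remaining_parts (E bs) (A @ B)"
    proof -
      have "filter (\<lambda>i. int i \<notin> E (b # bs)) A = filter (\<lambda>i. int i \<notin> E bs) A"
        and "filter (\<lambda>i. int i \<notin> E (b # bs)) B = filter (\<lambda>i. int i \<notin> E bs) B"
        using A B by (auto simp: E_Cons intro!: filter_cong)
      then show ?thesis by (simp add: remaining_parts_def I) (simp add: E_Cons)
    qed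
    have "sig n (X 1 ^ b * Qt n I) = (2 * (- 1) ^ n * (- 1) ^ length A) * (Qt n (A @ B) :: 'a mpoly)"
      unfolding step unfolding I by (subst alt_del_indicator) (use A B in \<open>auto simp: mult.assoc\<close>)
    then have "fold (\<lambda>b G. sig n (X 1 ^ b * G)) (b # bs) (Qt n I) =
        ?D ((2 * (- 1) ^ n * (- 1) ^ length A) * Qt n (A @ B))"
      unfolding fold_Cons o_apply by simp
    also have "\<dots> = (2 * (- 1) ^ n * (- 1) ^ length A) * ?D (Qt n (A @ B))"
      by (rule fold_sig_cmult) simp
    also have "?D (Qt n (A @ B)) = (if E bs \<subseteq> int ` set (A @ B)
       then 2 ^ length bs * (- 1) ^ (Suc n * length bs + position_sum (E bs) (A @ B)) * Qt n (remaining_parts (E bs) (A @ B))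
       else 0)"
      using Cons.prems by (intro Cons.IH) (auto simp: I sorted_wrt_append)
    finally show ?thesis
      unfolding sub pos rem by (simp add: power_add mult_ac)
  qed
qed

text \<open>Required by \<open>schur_eq_fold_ddiff\<close>, where the antisymmetrizer must
  annihilate divided differences.\<close>

instance dyadic :: ring_char_0
proof
  have "rat_of_dyadic (of_nat m) = of_nat m" for m
    by (induction m) (simp_all add: zero_dyadic.rep_eq one_dyadic.rep_eq plus_dyadic.rep_eq)
  then show "inj (of_nat :: nat \<Rightarrow> dyadic)"
    by (intro injI) (metis of_nat_eq_iff)
qed

theorem theorem9:
  fixes n k :: nat and \<alpha> I :: "nat list"
  assumes "1 \<le> k" and "k \<le> n"
    and "length \<alpha> = k" and "sorted \<alpha>" and "\<alpha> ! (k - 1) = n - k + 1"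
    and "strict_partition I" and "partition_le I (rho n)"
  shows "if length I mod 2 \<noteq> n mod 2 \<and> erased n k \<alpha> \<subseteq> int ` set I
    then nabla_B k n (Qt n I * schur k (rev \<alpha>)) =
      ((-1) ^ ((k - 1) * (n - 1) + 1 + position_sum (erased n k \<alpha>) I) * 2 ^ k *
        Qt n (remaining_parts (erased n k \<alpha>) I) :: dyadic mpoly)
    else nabla_B k n (Qt n I * schur k (rev \<alpha>)) = (0 :: dyadic mpoly)"
proof -
  let ?D = "fold (\<lambda>b G. sig n (X 1 ^ b * G)) :: nat list \<Rightarrow> dyadic mpoly \<Rightarrow> _"
  define l where "l = k - 1"
  have k: "k = Suc l" and n: "1 \<le> n" and l: "l < n" using assms by (auto simp: l_def)
  \<comment> \<open>The exponents of the variables from the second to the k-th; the list index of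
    \<alpha> starts at 0. The exponent of the first variable is n by
    \<open>\<alpha>_l\<close>.\<close>
  define bs where "bs = map (\<lambda>i. \<alpha> ! i + i) (rev [0..<l])"
  have \<alpha>_mono: "\<alpha> ! i \<le> \<alpha> ! j" if "i \<le> j" "j \<le> l" for i j
    using that assms(3,4) by (intro sorted_nth_mono) (auto simp: k)
  have \<alpha>_l: "\<alpha> ! l + l = n" using assms(2,5) by (simp add: k)
  have bs_sorted: "sorted_wrt (>) bs"
  proof -
    have "\<alpha> ! (l - Suc j) + (l - Suc j) < \<alpha> ! (l - Suc i) + (l - Suc i)" if "i < j" "j < l" for i j
      using that by (intro add_le_less_mono \<alpha>_mono) auto
    then show ?thesis by (simp add: bs_def sorted_wrt_iff_nth_less rev_nth)
  qed
  have bs_less: "b < n" if "b \<in> set bs" for b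
  proof -
    obtain i where "i < l" "b = \<alpha> ! i + i" using \<open>b \<in> set bs\<close> by (auto simp: bs_def)
    then show ?thesis using \<alpha>_mono[of i l] \<alpha>_l by simp
  qed
  have I: "sorted_wrt (>) I" "0 \<notin> set I" using assms(6) by (auto simp: strict_partition_def)
  have erased: "erased n k \<alpha> = (\<lambda>b. int n - int b) ` set bs"
    by (auto simp: erased_def bs_def k image_image algebra_simps intro!: image_cong)
  have bs_nth: "(n # bs) ! j = rev \<alpha> ! j + (k - 1 - j)" if "j < k" for j
    using that \<alpha>_l assms(3) by (cases j) (auto simp: bs_def rev_nth k Suc_diff_Suc)
  have "(\<Prod>j<length (n # bs). X (Suc j) ^ ((n # bs) ! j)) = (monomial k (\<lambda>j. rev \<alpha> ! j + (k - 1 - j)) :: dyadic mpoly)"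
    unfolding monomial_def by (rule prod.cong) (auto simp: bs_def k bs_nth[unfolded bs_def k])
  then have schur: "schur k (rev \<alpha>) = fold ddiff (sym_word k) (\<Prod>j<length (n # bs). X (Suc j) ^ ((n # bs) ! j) :: dyadic mpoly)"
    by (simp only: schur_eq_fold_ddiff)
  have "nabla_B k n (Qt n I * schur k (rev \<alpha>)) =
      nabla_B k n (fold ddiff (sym_word k) (Qt n I * (\<Prod>j<length (n # bs). X (Suc j) ^ ((n # bs) ! j)))  :: dyadic mpoly)"
    unfolding schur using set_sym_word[of k] assms(2)
    by (subst fold_ddiff_mult_invariant) (auto intro!: reflect_Qt)
  also have "\<dots> = (sig n ^^ length (n # bs)) (Qt n I * (\<Prod>j<length (n # bs). X (Suc j) ^ ((n # bs) ! j)))"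
    using assms(2) by (simp add: sig_power_eq_nabla_B bs_def k del: funpow.simps)
  also have "\<dots> = ?D (n # bs) (Qt n I)"
    using l bs_less by (intro sig_power_monomial) (auto simp: bs_def reflect_Qt)
  also have "\<dots> = ?D bs ((if length I mod 2 \<noteq> n mod 2 then - 2 else 0) * Qt n I)"
    using sig_X_power_n_Qt[OF n I(2), where ?'a = dyadic] by simp
  also have "\<dots> = (if length I mod 2 \<noteq> n mod 2 then - 2 else 0) * ?D bs (Qt n I)"
    by (rule fold_sig_cmult) simp
  also have "?D bs (Qt n I) = (if erased n k \<alpha> \<subseteq> int ` set I
     then 2 ^ l * (- 1) ^ (Suc n * l + position_sum (erased n k \<alpha>) I) * Qt n (remaining_parts (erased n k \<alpha>) I)
     else 0)"
    using fold_sig_Qt[OF n bs_sorted bs_less I, where ?'a = dyadic] by (simp add: erased bs_def)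
  finally have main: "nabla_B k n (Qt n I * schur k (rev \<alpha>)) = (if length I mod 2 \<noteq> n mod 2 then - 2 else 0) *
      (if erased n k \<alpha> \<subseteq> int ` set I
       then 2 ^ l * (- 1) ^ (Suc n * l + position_sum (erased n k \<alpha>) I) * Qt n (remaining_parts (erased n k \<alpha>) I)
       else 0 :: dyadic mpoly)" .
  \<comment> \<open>The factors n + 1 and n - 1 have equal parity. The remaining sign and the last
    factor 2 come from the -2 of the first exponent.\<close>
  have "even (Suc n * l) \<longleftrightarrow> even ((k - 1) * (n - 1))"
    using n by (auto simp: k)
  then have "(- 1) ^ (Suc n * l) = ((- 1) ^ ((k - 1) * (n - 1)) :: dyadic mpoly)"
    by (simp add: minus_one_power_iff)
  then show ?thesis
    unfolding main by (simp add: k power_add mult_ac)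
qed

end
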